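(* There exists an integer $N_0$ such that every integer $n \ge N_0$ can be represented (i) as a sum of two positive integers $n = x + y$ such that $\Omega(x + ny) \le 3$, or (ii) as a sum of two positive integers $n = x + y$ such that $\Omega(x^2 + ny^2) \le 4$.
   Context: For a positive integer $m$, $\Omega(m)$ denotes the number of prime factors of $m$ counted with multiplicity. "Every sufficiently large integer $n$" means every integer $n$ at least some fixed bound $N_0$. *)

theory Defs
  imports "HOL-Computational_Algebra.Primes"
begin

definition bigOmega :: "nat \<Rightarrow> nat" where
  "bigOmega m = size (prime_factorization m)"

end

theory Submission
  imports Defs "HOL-Analysis.Analysis" "HOL-Number_Theory.Cong" "HOL-Real_Asymp.Real_Asymp"
begin

text \<open>
  For \<open>q = n - 1\<close> and \<open>n = x + y\<close> one has \<open>x + n * y = 1 + q * (y + 1)\<close>, so alternative (i) always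
  holds if the progression 1 modulo \<open>q\<close> contains a number with at most three prime factors below
  about \<open>q\<^sup>2\<close>. This is a weighted linear sieve of level almost \<open>q\<close>: among the terms without
  prime factors below \<open>q powr (1/5)\<close>, a term with at least four prime factors has total Richert
  weight \<open>\<Sum> (1 - ln p / ln y) \<ge> 1\<close> over its primes \<open>p < y\<close>, where \<open>y\<^sup>3\<close> exceeds all terms. Upper
  bounds for the number of sifted multiples of each \<open>p\<close> show that the average weight is
  smaller than 1. The upper and lower sieve bounds are proved by a simultaneous induction on Buchstab's
  identity, with exponentials in place of the optimal sieve functions, and the density hypothesis
  of the sieve comes from Mertens' theorems.
\<close>

section \<open>Mertens' theorems\<close>

text \<open>The parameters are tied together as follows. The terms reach \<open>1 + q * q\<close>,
  so \<open>y\<close> must exceed \<open>q powr (2/3)\<close>, and \<open>17/25\<close> is just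
  above \<open>2/3\<close>. The level \<open>q powr (49/50)\<close> leaves a power of
  \<open>q\<close> to pay for logarithms in the error. With \<open>z = q powr (1/5)\<close> the
  sieving parameter is \<open>4.9\<close>, where the lower bound loses the proportion
  \<open>4 powr (-1.9) < 9/125\<close>. After a prime \<open>p >= z\<close> is split off, the
  parameter of \<open>D / p\<close> is at most \<open>3.9\<close>, so only the hyperbolic upper
  bound \<open>4.77 / s\<close> enters the weighted sum, which is at most \<open>22/25\<close>. The
  margin is \<open>1 - 9/125 - 22/25 = 6/125\<close>. The obstacle is that these constants need
  density ratios within a factor \<open>1 + 1/1000\<close> of \<open>ln z / ln w\<close> for every
  \<open>w > 1\<close>, while Mertens' theorems with errors of size \<open>1 / ln w\<close> give
  this only for large \<open>w\<close>. Hence only terms coprime to a fixed factorial are sieved,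
  which costs a constant factor in their number.\<close>

lemma finite_primes_le [simp]: "finite {p::nat. prime p \<and> p \<le> N}"
  by (rule finite_subset[of _ "{..N}"]) auto

lemma prod_primes_dvd:
  fixes n :: nat
  assumes "finite S" "\<And>p. p \<in> S \<Longrightarrow> prime p" "\<And>p. p \<in> S \<Longrightarrow> p dvd n"
  shows "\<Prod>S dvd n"
  using assms
proof (induction S rule: finite_induct)
  case (insert p S)
  have "coprime p (\<Prod>S)"
    by (rule prod_coprime_right) (use insert primes_coprime in \<open>metis insertCI\<close>)
  then show ?case
    using insert by (simp add: divides_mult)
qed simp

text \<open>Chebyshev's argument: the primes in \<open>(m, 2m]\<close> all divide the binomial
  coefficient \<open>2m choose m\<close>, which is at most \<open>4 ^ m\<close>.\<close>

lemma sum_ln_primes_le: "(\<Sum>p | prime p \<and> p \<le> N. ln (real p)) \<le> 4 * real N"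
proof (induction N rule: less_induct)
  case (less N)
  show ?case
  proof (cases "N \<le> 2")
    case True
    have "(\<Sum>p | prime p \<and> p \<le> N. ln (real p)) \<le> (\<Sum>p | prime p \<and> p \<le> N. 1)"
    proof (rule sum_mono)
      show "ln (real p) \<le> 1" if "p \<in> {p. prime p \<and> p \<le> N}" for p
      proof -
        have "p = 2" using that True prime_ge_2_nat[of p] by auto
        then show ?thesis using ln_2_less_1 by simp
      qed
    qed
    also have "\<dots> \<le> (\<Sum>p\<in>{1..N}. 1)"
      by (rule sum_mono2) (auto simp: prime_gt_0_nat Suc_leI)
    also have "\<dots> \<le> 4 * real N" by simp
    finally show ?thesis .
  next
    case False
    \<comment> \<open>Half of \<open>N\<close> rounded up, so that \<open>2 * m\<close> covers odd
      \<open>N\<close>; then \<open>6 * m <= 3 * N + 3 <= 4 * N\<close> because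
      \<open>N >= 3\<close>.\<close>
    define m where "m = (N + 1) div 2"
    have m: "m < N" "N \<le> 2 * m" "2 * m \<le> N + 1" "1 \<le> m" using False by (auto simp: m_def)
    define S where "S = {p. prime p \<and> m < p \<and> p \<le> 2 * m}"
    have finS: "finite S" by (rule finite_subset[of _ "{..2*m}"]) (auto simp: S_def)
    have dvd: "\<Prod>S dvd (2 * m) choose m"
    proof (rule prod_primes_dvd[OF finS])
      show "p dvd (2 * m) choose m" if "p \<in> S" for p
      proof -
        have "p dvd fact (2 * m)" "\<not> p dvd fact m" "prime p"
          using that by (auto simp: S_def prime_dvd_fact_iff)
        moreover have "fact m * fact m * ((2 * m) choose m) = (fact (2 * m) :: nat)"
          using binomial_fact_lemma[of m "2*m"] by simp
        ultimately show ?thesis by (metis prime_dvd_mult_iff)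
      qed
    qed (auto simp: S_def)
    have "\<Prod>S \<le> (2 * m) choose m"
      by (rule dvd_imp_le[OF dvd]) simp
    also have "\<dots> \<le> 2 ^ (2 * m)" by (rule binomial_le_pow2)
    finally have "real (\<Prod>S) \<le> 2 ^ (2 * m)"
      by (metis of_nat_le_iff of_nat_numeral of_nat_power)
    have "(\<Sum>p\<in>S. ln (real p)) = ln (real (\<Prod>S))"
      unfolding of_nat_prod by (rule ln_prod[symmetric]) (auto simp: S_def prime_gt_0_nat)
    also have "\<dots> \<le> ln (2 ^ (2 * m))"
    proof -
      have "0 < real (\<Prod>S)" by (auto simp: S_def prime_gt_0_nat intro!: prod_pos)
      then show ?thesis using \<open>real (\<Prod>S) \<le> 2 ^ (2 * m)\<close> by simp
    qed
    also have "\<dots> = real (2 * m) * ln 2" by (simp add: ln_realpow)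
    also have "\<dots> \<le> real (2 * m) * 1" by (rule mult_left_mono) (use ln_2_less_1 in auto)
    finally have S: "(\<Sum>p\<in>S. ln (real p)) \<le> 2 * real m" by simp
    have "(\<Sum>p | prime p \<and> p \<le> N. ln (real p)) \<le> (\<Sum>p \<in> {p. prime p \<and> p \<le> m} \<union> S. ln (real p))"
      by (rule sum_mono2) (use m finS in \<open>auto simp: S_def prime_gt_0_nat Suc_leI\<close>)
    also have "\<dots> = (\<Sum>p | prime p \<and> p \<le> m. ln (real p)) + (\<Sum>p\<in>S. ln (real p))"
      by (rule sum.union_disjoint) (use finS in \<open>auto simp: S_def\<close>)
    also have "\<dots> \<le> 4 * real m + 2 * real m"
      using less.IH[of m] m S by auto
    also have "\<dots> \<le> 4 * real N" using m False by linarith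
    finally show ?thesis .
  qed
qed

section \<open>Legendre's formula and Mertens' first theorem\<close>

text \<open>Legendre's formula for the exponent of \<open>p\<close> in \<open>N!\<close>, in
  recursive form: only multiples \<open>p * m\<close> contribute, each one more than
  \<open>m\<close> does.\<close>

lemma sum_multiplicity_rec:
  assumes "prime (p::nat)"
  shows "(\<Sum>n\<in>{1..N}. multiplicity p n) = N div p + (\<Sum>n\<in>{1..N div p}. multiplicity p n)"
proof -
  have p: "p > 0" using assms prime_gt_0_nat by auto
  have "(\<Sum>n\<in>{1..N}. multiplicity p n) = (\<Sum>n\<in>(\<lambda>m. p * m) ` {1..N div p}. multiplicity p n)"
  proof (rule sum.mono_neutral_right)
    show "(*) p ` {1..N div p} \<subseteq> {1..N}"
      using p by (auto simp: less_eq_div_iff_mult_less_eq mult.commute)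
    show "\<forall>i\<in>{1..N} - (*) p ` {1..N div p}. multiplicity p i = 0"
    proof
      fix i assume i: "i \<in> {1..N} - (*) p ` {1..N div p}"
      have "\<not> p dvd i"
      proof
        assume "p dvd i"
        then obtain m where m: "i = p * m" by auto
        then have "m \<in> {1..N div p}"
          using i p by (auto simp: less_eq_div_iff_mult_less_eq mult.commute Suc_le_eq)
        then show False using i m by auto
      qed
      then show "multiplicity p i = 0" by (rule not_dvd_imp_multiplicity_0)
    qed
  qed auto
  also have "\<dots> = (\<Sum>m\<in>{1..N div p}. multiplicity p (p * m))"
    by (subst sum.reindex) (use p in \<open>auto simp: inj_on_def\<close>)
  also have "\<dots> = (\<Sum>m\<in>{1..N div p}. 1 + multiplicity p m)"
    by (rule sum.cong) (use assms in \<open>auto intro!: multiplicity_times_same dest: prime_gt_1_nat\<close>)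
  finally show ?thesis by (subst (asm) sum.distrib) auto
qed

lemma sum_multiplicity_le:
  assumes "prime (p::nat)"
  shows "real (\<Sum>n\<in>{1..N}. multiplicity p n) \<le> real N / (real p - 1)"
proof (induction N rule: less_induct)
  case (less N)
  have p: "p \<ge> 2" using assms prime_ge_2_nat by auto
  show ?case
  proof (cases "N = 0")
    case False
    have "real (\<Sum>n\<in>{1..N}. multiplicity p n)
      = real (N div p) + real (\<Sum>n\<in>{1..N div p}. multiplicity p n)"
      using sum_multiplicity_rec[OF assms, of N] by simp
    also have "\<dots> \<le> real (N div p) + real (N div p) / (real p - 1)"
      using less.IH[of "N div p"] False p by auto
    also have "\<dots> = real (N div p) * (real p / (real p - 1))"
      using p by (simp add: field_simps)
    also have "\<dots> \<le> real N / real p * (real p / (real p - 1))"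
      by (rule mult_right_mono) (use p in \<open>auto simp: of_nat_div_le_of_nat\<close>)
    finally show ?thesis using p by simp
  qed auto
qed

text \<open>The range of the sum depends on \<open>N\<close> and not on \<open>n\<close>, so that
  the sums can be exchanged when \<open>n\<close> runs up to \<open>N\<close>.\<close>

lemma ln_nat_eq_sum:
  assumes "0 < n" "n \<le> N"
  shows "ln (real n) = (\<Sum>p | prime p \<and> p \<le> N. real (multiplicity p n) * ln (real p))"
proof -
  have "real n = real (\<Prod>p\<in>prime_factors n. p ^ multiplicity p n)"
    using assms prime_factorization_nat[of n] by simp
  also have "ln \<dots> = (\<Sum>p\<in>prime_factors n. real (multiplicity p n) * ln (real p))"
    unfolding of_nat_prod of_nat_power
    by (subst ln_prod) (auto simp: in_prime_factors_iff prime_gt_0_nat ln_realpow)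
  also have "\<dots> = (\<Sum>p | prime p \<and> p \<le> N. real (multiplicity p n) * ln (real p))"
    by (rule sum.mono_neutral_left)
      (use assms in \<open>auto simp: in_prime_factors_iff not_dvd_imp_multiplicity_0 dest!: dvd_imp_le\<close>)
  finally show ?thesis .
qed

lemma ln_fact_eq_sum:
  "ln (fact N) = (\<Sum>p | prime p \<and> p \<le> N. real (\<Sum>n\<in>{1..N}. multiplicity p n) * ln (real p))"
proof -
  have "ln (fact N :: real) = (\<Sum>n\<in>{1..N}. ln (real n))"
    unfolding fact_prod of_nat_prod by (rule ln_prod) auto
  also have "\<dots> = (\<Sum>n\<in>{1..N}. \<Sum>p | prime p \<and> p \<le> N. real (multiplicity p n) * ln (real p))"
    by (rule sum.cong) (auto intro!: ln_nat_eq_sum)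
  also have "\<dots> = (\<Sum>p | prime p \<and> p \<le> N. \<Sum>n\<in>{1..N}. real (multiplicity p n) * ln (real p))"
    by (rule sum.swap)
  finally show ?thesis by (simp add: sum_distrib_right)
qed

lemma ln_fact_le: "N \<ge> 1 \<Longrightarrow> ln (fact N) \<le> real N * ln (real N)"
proof -
  assume N: "N \<ge> 1"
  have "ln (fact N :: real) \<le> ln (real N ^ N)"
    using N by (subst ln_le_cancel_iff) (auto intro: order_trans[OF fact_le_power])
  then show ?thesis using N by (simp add: ln_realpow)
qed

lemma ln_fact_ge:
  assumes "N \<ge> 1"
  shows "real N * ln (real N) - real N \<le> ln (fact N)"
  using assms
proof (induction N rule: nat_induct_at_least)
  case (Suc N)
  define x where "x = real N"
  have x: "x \<ge> 1" using Suc by (simp add: x_def)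
  have "ln ((x + 1) / x) \<le> 1 / x"
    using ln_add_one_self_le_self[of "1 / x"] x by (simp add: add_divide_distrib)
  then have "x * ln (x + 1) \<le> x * ln x + 1" using x by (simp add: ln_div field_simps)
  moreover have "ln (fact (Suc N) :: real) = ln (x + 1) + ln (fact N)"
    using ln_mult[of "real (Suc N)" "fact N"] by (simp add: x_def add.commute)
  ultimately show ?case using Suc.IH by (simp add: x_def algebra_simps)
qed simp

text \<open>Controls the contribution of higher prime powers in Mertens' first theorem. The term
  \<open>(ln N + 2) / N\<close> is a tail estimate that makes the induction close, with equality at
  \<open>N = 1\<close>.\<close>

lemma sum_ln_over_n_pred:
  "N \<ge> 1 \<Longrightarrow> (\<Sum>n\<in>{2..N}. ln (real n) / (real n * (real n - 1))) \<le> 2 - (ln (real N) + 2) / real N"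
proof (induction N rule: nat_induct_at_least)
  case (Suc N)
  define x where "x = real N"
  have x: "x \<ge> 1" using Suc by (simp add: x_def)
  have "ln ((x + 1) / x) \<le> 1 / x"
    using ln_add_one_self_le_self[of "1 / x"] x by (simp add: add_divide_distrib)
  then have l: "ln (x + 1) \<le> ln x + 1 / x" using x by (simp add: ln_div)
  have "(x + 1) * ln (x + 1) \<le> (x + 1) * ln x + (x+1) / x"
    using mult_left_mono[OF l, of "x + 1"] x by (simp add: algebra_simps)
  also have "(x + 1) / x \<le> 2" using x by (simp add: field_simps)
  finally have "(x + 1) * ln (x + 1) \<le> (x + 1) * ln x + 2" by simp
  then have "ln (x + 1) / ((x + 1) * x) \<le> (ln x + 2) / x - (ln (x + 1) + 2) / (x + 1)"
  proof -
    assume "(x + 1) * ln (x + 1) \<le> (x + 1) * ln x + 2"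
    then have "ln (x + 1) / ((x + 1) * x) \<le> ((x + 1) * (ln x + 2) - x * (ln (x + 1) + 2)) / ((x + 1) * x)"
      using x by (intro divide_right_mono) (auto simp: algebra_simps)
    also have "\<dots> = (ln x + 2) / x - (ln (x + 1) + 2) / (x + 1)"
      using x by (simp add: diff_divide_distrib)
    finally show ?thesis .
  qed
  moreover have "(\<Sum>n\<in>{2..Suc N}. ln (real n) / (real n * (real n - 1))) =
     (\<Sum>n\<in>{2..N}. ln (real n) / (real n * (real n - 1))) + ln (x + 1) / ((x + 1) * x)"
    using Suc by (simp add: x_def add.commute)
  ultimately show ?case using Suc.IH by (simp add: x_def add.commute)
qed simp

text \<open>Two estimates of \<open>ln (N!)\<close> are compared: Legendre's formula gives at least
  the sum of \<open>(N/p - 1) * ln p\<close>, and \<open>N ln N\<close> is an upper bound. The 4 is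
  Chebyshev's constant.\<close>

lemma mertens_first_upper:
  assumes "N \<ge> 1"
  shows "(\<Sum>p | prime p \<and> p \<le> N. ln (real p) / real p) \<le> ln (real N) + 4"
proof -
  let ?P = "{p. prime p \<and> p \<le> N}"
  have "real N * (\<Sum>p\<in>?P. ln (real p) / real p) - (\<Sum>p\<in>?P. ln (real p))
     = (\<Sum>p\<in>?P. (real N / real p - 1) * ln (real p))"
    by (simp add: sum_distrib_left sum_subtractf algebra_simps)
  also have "\<dots> \<le> (\<Sum>p\<in>?P. real (\<Sum>n\<in>{1..N}. multiplicity p n) * ln (real p))"
  proof (intro sum_mono mult_right_mono)
    fix p assume p: "p \<in> ?P"
    have "real N / real p - 1 \<le> real (N div p)"
      using floor_divide_of_nat_eq[of N p, where 'a = real] by linarith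
    also have "\<dots> \<le> real (\<Sum>n\<in>{1..N}. multiplicity p n)"
      using p by (subst sum_multiplicity_rec) (auto intro: sum_nonneg)
    finally show "real N / real p - 1 \<le> real (\<Sum>n\<in>{1..N}. multiplicity p n)" .
  qed (auto simp: prime_gt_0_nat Suc_leI)
  also have "\<dots> \<le> real N * ln (real N)"
    using ln_fact_eq_sum[of N] ln_fact_le[OF assms] by simp
  finally have "real N * (\<Sum>p\<in>?P. ln (real p) / real p) \<le> real N * (ln (real N) + 4)"
    using sum_ln_primes_le[of N] by (simp add: algebra_simps)
  then show ?thesis using assms by simp
qed

text \<open>The opposite comparison, with exponents at most \<open>N / (p - 1)\<close>. The loss of
  3 is 1 from \<open>ln_fact_ge\<close> and 2 from the sum of
  \<open>ln p / (p * (p - 1))\<close>.\<close>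

lemma mertens_first_lower:
  assumes "N \<ge> 1"
  shows "(\<Sum>p | prime p \<and> p \<le> N. ln (real p) / real p) \<ge> ln (real N) - 3"
proof -
  let ?P = "{p. prime p \<and> p \<le> N}"
  have "real N * ln (real N) - real N \<le> (\<Sum>p\<in>?P. real (\<Sum>n\<in>{1..N}. multiplicity p n) * ln (real p))"
    using ln_fact_eq_sum[of N] ln_fact_ge[OF assms] by simp
  also have "\<dots> \<le> (\<Sum>p\<in>?P. real N / (real p - 1) * ln (real p))"
    by (intro sum_mono mult_right_mono sum_multiplicity_le) (auto simp: prime_gt_0_nat Suc_leI)
  also have "\<dots> = (\<Sum>p\<in>?P. real N * (ln (real p) / real p + ln (real p) / (real p * (real p - 1))))"
  proof (rule sum.cong)
    fix p assume "p \<in> ?P"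
    then have "p \<ge> 2" using prime_ge_2_nat by auto
    then show "real N / (real p - 1) * ln (real p) = real N * (ln (real p) / real p + ln (real p) / (real p * (real p - 1)))"
      by (simp add: field_simps)
  qed auto
  also have "\<dots> = real N * ((\<Sum>p\<in>?P. ln (real p) / real p) + (\<Sum>p\<in>?P. ln (real p) / (real p * (real p - 1))))"
    by (simp add: sum_distrib_left sum.distrib distrib_left)
  finally have "real N * (ln (real N) - 1) \<le> real N * ((\<Sum>p\<in>?P. ln (real p) / real p) + (\<Sum>p\<in>?P. ln (real p) / (real p * (real p - 1))))"
    by (simp add: algebra_simps)
  then have 1: "ln (real N) - 1 \<le> (\<Sum>p\<in>?P. ln (real p) / real p) + (\<Sum>p\<in>?P. ln (real p) / (real p * (real p - 1)))"
    using assms by simp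
  have "(\<Sum>p\<in>?P. ln (real p) / (real p * (real p - 1))) \<le> (\<Sum>p\<in>{2..N}. ln (real p) / (real p * (real p - 1)))"
    by (rule sum_mono2) (auto simp: prime_ge_2_nat)
  also have "\<dots> \<le> 2 - (ln (real N) + 2) / real N" by (rule sum_ln_over_n_pred[OF assms])
  also have "\<dots> \<le> 2" using assms by simp
  finally show ?thesis using 1 by linarith
qed

text \<open>Partial summation, written as an induction with the invariant
  \<open>\<Sum> 1/p - E N / ln N\<close>, where \<open>E\<close> is the error term of Mertens' first theorem.\<close>

lemma mertens_second_upper:
  assumes "2 \<le> w" "w \<le> N"
  shows "(\<Sum>p | prime p \<and> w < p \<and> p \<le> N. 1 / real p) \<le> ln (ln (real N)) - ln (ln (real w)) + 8 / ln (real w)"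
proof -
  define E where "E = (\<lambda>N. (\<Sum>p | prime p \<and> p \<le> N. ln (real p) / real p) - ln (real N))"
  define T where "T = (\<lambda>N. \<Sum>p | prime p \<and> w < p \<and> p \<le> N. 1 / real p)"
  have E: "E N \<le> 4" "E N \<ge> -3" if "N \<ge> 1" for N
    using mertens_first_upper[OF that] mertens_first_lower[OF that] by (auto simp: E_def)
  have "T N - E N / ln (real N) \<le> ln (ln (real N)) - ln (ln (real w)) - E w / ln (real w) + 4 / ln (real w) - 4 / ln (real N)"
    using assms(2)
  proof (induction N rule: nat_induct_at_least)
    case base
    have "{p. prime p \<and> w < p \<and> p \<le> w} = {}" by auto
    then show ?case by (simp only: T_def sum.empty)
  next
    case (Suc N)
    define a where "a = (if prime (Suc N) then ln (real (Suc N)) / real (Suc N) else 0)"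
    define L where "L = ln (real N)"
    define L' where "L' = ln (real (Suc N))"
    have L: "0 < L" "L < L'" using Suc assms by (auto simp: L_def L'_def)
    have s1: "{p. prime p \<and> p \<le> Suc N} = (if prime (Suc N) then insert (Suc N) {p. prime p \<and> p \<le> N} else {p. prime p \<and> p \<le> N})"
      by (auto simp: le_Suc_eq)
    have s2: "{p. prime p \<and> w < p \<and> p \<le> Suc N} = (if prime (Suc N) then insert (Suc N) {p. prime p \<and> w < p \<and> p \<le> N} else {p. prime p \<and> w < p \<and> p \<le> N})"
      using Suc by (auto simp: le_Suc_eq)
    have f: "finite {p. prime p \<and> w < p \<and> p \<le> N}" by (rule finite_subset[of _ "{..N}"]) auto
    have ES: "E (Suc N) = E N + a - (L' - L)" unfolding E_def s1 a_def L_def L'_def by simp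
    have TS: "T (Suc N) = T N + a / L'" unfolding T_def s2 a_def L'_def using f by simp
    \<comment> \<open>One step of Abel summation: the new term \<open>a / L'\<close> of
      \<open>T\<close> cancels the one inside \<open>E\<close>, whether or not \<open>Suc N\<close>
      is prime.\<close>
    have "T (Suc N) - E (Suc N) / L' = T N - E N / L + (L' - L) / L' + E N * (1 / L - 1 / L')"
      unfolding ES TS using L by (simp add: field_simps)
    also have "E N * (1 / L - 1 / L') \<le> 4 * (1 / L - 1 / L')"
      by (rule mult_right_mono) (use E[of N] L Suc assms in \<open>auto simp: field_simps\<close>)
    also have "(L' - L) / L' \<le> ln L' - ln L"
    proof -
      have "ln (L / L') \<le> L / L' - 1" by (rule ln_le_minus_one) (use L in auto)
      then show ?thesis using L by (simp add: ln_div field_simps)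
    qed
    finally have "T (Suc N) - E (Suc N) / L' \<le> T N - E N / L + (ln L' - ln L) + 4 * (1 / L - 1 / L')" by simp
    then show ?case using Suc.IH by (fold L_def L'_def) (simp add: algebra_simps)
  qed
  \<comment> \<open>The bound 4 for \<open>E N\<close> and for \<open>- E w\<close>, with the
    telescoped \<open>4 / ln w - 4 / ln N\<close>, adds up to \<open>8 / ln w\<close>.\<close>
  moreover have "E N / ln (real N) \<le> 4 / ln (real N)"
    by (rule divide_right_mono) (use E[of N] assms in auto)
  moreover have "- E w / ln (real w) \<le> 4 / ln (real w)"
    by (rule divide_right_mono) (use E[of w] assms in auto)
  ultimately show ?thesis unfolding T_def by simp
qed

lemma sum_inverse_n_pred:
  assumes "1 \<le> w" "w \<le> N"
  shows "(\<Sum>n\<in>{w<..N}. 1 / (real n * (real n - 1))) = 1 / real w - 1 / real N"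
  using assms(2)
proof (induction N rule: nat_induct_at_least)
  case (Suc N)
  have "{w<..Suc N} = insert (Suc N) {w<..N}" using Suc by auto
  then have "(\<Sum>n\<in>{w<..Suc N}. 1 / (real n * (real n - 1))) = 1 / ((1 + real N) * real N) + (1 / real w - 1 / real N)"
    using Suc.IH by simp
  also have "1 / ((1 + real N) * real N) = 1 / real N - 1 / (1 + real N)"
    using Suc assms(1) by (simp add: field_simps)
  finally show ?case by simp
qed simp

text \<open>Mertens' second theorem is exponentiated. As
  \<open>1 / (1 - 1/p) = 1 + 1/p + 1/(p * (p - 1))\<close>, this costs only a convergent tail, at
  most \<open>1 / w\<close>.\<close>

lemma mertens_product_nat:
  assumes "2 \<le> w" "w \<le> N"
  shows "(\<Prod>p | prime p \<and> w < p \<and> p \<le> N. 1 / (1 - 1 / real p))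
     \<le> ln (real N) / ln (real w) * exp (8 / ln (real w) + 1 / real w)"
proof -
  let ?P = "{p. prime p \<and> w < p \<and> p \<le> N}"
  have "(\<Prod>p\<in>?P. 1 / (1 - 1 / real p)) \<le> (\<Prod>p\<in>?P. exp (1 / real p + 1 / (real p * (real p - 1))))"
  proof (rule prod_mono)
    fix p assume "p \<in> ?P"
    then have p: "real p \<ge> 2" using assms by auto
    then have "1 / (1 - 1 / real p) = 1 + (1 / real p + 1 / (real p * (real p - 1)))"
      by (simp add: field_simps)
    also have "\<dots> \<le> exp (1 / real p + 1 / (real p * (real p - 1)))" by (rule exp_ge_add_one_self)
    finally show "0 \<le> 1 / (1 - 1 / real p) \<and> 1 / (1 - 1 / real p) \<le> exp (1 / real p + 1 / (real p * (real p - 1)))"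
      using p by simp
  qed
  also have "\<dots> = exp ((\<Sum>p\<in>?P. 1 / real p) + (\<Sum>p\<in>?P. 1 / (real p * (real p - 1))))"
    by (subst exp_sum[symmetric]) (auto simp: sum.distrib intro: finite_subset[of _ "{..N}"])
  also have "\<dots> \<le> exp ((ln (ln (real N)) - ln (ln (real w)) + 8 / ln (real w)) + 1 / real w)"
  proof -
    have "(\<Sum>p\<in>?P. 1 / (real p * (real p - 1))) \<le> (\<Sum>n\<in>{w<..N}. 1 / (real n * (real n - 1)))"
      by (rule sum_mono2) auto
    also have "\<dots> \<le> 1 / real w" using sum_inverse_n_pred[of w N] assms by simp
    finally show ?thesis using mertens_second_upper[OF assms] by simp
  qed
  also have "\<dots> = ln (real N) / ln (real w) * exp (8 / ln (real w) + 1 / real w)"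
    using assms by (simp add: exp_add exp_diff)
  finally show ?thesis .
qed

lemma mertens_product:
  assumes "(\<epsilon>::real) > 0"
  obtains w0 :: nat where "w0 \<ge> 2"
    "\<And>w z. real w0 \<le> w \<Longrightarrow> w \<le> z \<Longrightarrow>
       (\<Prod>p | prime p \<and> w \<le> real p \<and> real p < z. 1 / (1 - 1 / real p)) \<le> (1 + \<epsilon>) * (ln z / ln w)"
proof -
  have "((\<lambda>w::real. ln w / ln (w - 1) * exp (8 / ln (w - 1) + 1 / (w - 1))) \<longlongrightarrow> 1) at_top"
    by real_asymp
  then have "eventually (\<lambda>w::real. ln w / ln (w - 1) * exp (8 / ln (w - 1) + 1 / (w - 1)) < 1 + \<epsilon>) at_top"
    by (rule order_tendstoD(2)) (use assms in simp)
  then obtain W where W: "\<And>w. w \<ge> W \<Longrightarrow> ln w / ln (w - 1) * exp (8 / ln (w - 1) + 1 / (w - 1)) < 1 + \<epsilon>"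
    by (auto simp: eventually_at_top_linorder)
  define w0 where "w0 = max 3 (nat \<lceil>W\<rceil>)"
  show ?thesis
  proof (rule that)
    fix w z :: real assume w: "real w0 \<le> w" and z: "w \<le> z"
    have w3: "w \<ge> 3" "w \<ge> W" using w by (auto simp: w0_def) linarith
    \<comment> \<open>Rounding up and subtracting one turns \<open>w <= p\<close> into
      \<open>a < p\<close> and \<open>p < z\<close> into \<open>p <= b\<close>. Since
      \<open>a\<close> may be as small as \<open>w - 1\<close>, the limit above is taken with that
      shift.\<close>
    define a where "a = nat \<lceil>w\<rceil> - 1"
    define b where "b = nat \<lceil>z\<rceil> - 1"
    have ceil: "\<lceil>w\<rceil> \<ge> 3" "\<lceil>z\<rceil> \<ge> \<lceil>w\<rceil>" using w3 ceiling_mono[OF z] by (auto simp: le_ceiling_iff)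
    have ra: "real a = real_of_int \<lceil>w\<rceil> - 1" "real b = real_of_int \<lceil>z\<rceil> - 1"
    proof -
      have "1 \<le> nat \<lceil>w\<rceil>" "1 \<le> nat \<lceil>z\<rceil>" using ceil by linarith+
      then show "real a = real_of_int \<lceil>w\<rceil> - 1" "real b = real_of_int \<lceil>z\<rceil> - 1"
        unfolding a_def b_def using ceil by (simp_all only: of_nat_diff of_nat_1)
    qed
    have ab: "2 \<le> a" "a \<le> b" unfolding a_def b_def using ceil by linarith+
    have a: "w - 1 \<le> real a" "real b \<le> z" unfolding ra using ceiling_correct[of w] ceiling_correct[of z] by linarith+
    have "(\<Prod>p | prime p \<and> w \<le> real p \<and> real p < z. 1 / (1 - 1 / real p))
       = (\<Prod>p | prime p \<and> a < p \<and> p \<le> b. 1 / (1 - 1 / real p))"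
    proof (rule prod.cong)
      have "(w \<le> real p) = (a < p)" "(real p < z) = (p \<le> b)" for p
      proof -
        show "(w \<le> real p) = (a < p)"
          using ceil by (simp add: a_def less_diff_conv2 flip: ceiling_le_iff) linarith
        show "(real p < z) = (p \<le> b)"
        proof -
          have "real p < z \<longleftrightarrow> int p < \<lceil>z\<rceil>" by (simp add: less_ceiling_iff)
          also have "\<dots> \<longleftrightarrow> p \<le> b" unfolding b_def using ceil by linarith
          finally show ?thesis .
        qed
      qed
      then show "{p. prime p \<and> w \<le> real p \<and> real p < z} = {p. prime p \<and> a < p \<and> p \<le> b}" by simp
    qed simp
    also have "\<dots> \<le> ln (real b) / ln (real a) * exp (8 / ln (real a) + 1 / real a)"
      by (rule mertens_product_nat[OF ab])
    also have "\<dots> \<le> ln z / ln (w - 1) * exp (8 / ln (w - 1) + 1 / (w - 1))"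
    proof (intro mult_mono frac_le)
      have "8 / ln (real a) \<le> 8 / ln (w - 1)"
        by (rule divide_left_mono) (use a w3 in auto)
      moreover have "1 / real a \<le> 1 / (w - 1)"
        by (rule divide_left_mono) (use a w3 in auto)
      ultimately show "exp (8 / ln (real a) + 1 / real a) \<le> exp (8 / ln (w - 1) + 1 / (w - 1))"
        by simp
    qed (use a ab w3 z in auto)
    also have "\<dots> = ln w / ln (w - 1) * exp (8 / ln (w - 1) + 1 / (w - 1)) * (ln z / ln w)"
      using w3 by simp
    also have "\<dots> \<le> (1 + \<epsilon>) * (ln z / ln w)"
      by (rule mult_right_mono) (use W[OF w3(2)] w3 z in auto)
    finally show "(\<Prod>p | prime p \<and> w \<le> real p \<and> real p < z. 1 / (1 - 1 / real p)) \<le> (1 + \<epsilon>) * (ln z / ln w)" .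
  qed (simp add: w0_def)
qed

section \<open>A linear sieve\<close>

definition prod_minus :: "nat set \<Rightarrow> real \<Rightarrow> real" where
  "prod_minus P z = (\<Prod>p | p \<in> P \<and> real p < z. 1 - 1 / real p)"

text \<open>Bookkeeping for the remainder: errors divided by \<open>p\<close> at each Buchstab step
  accumulate to this product.\<close>

definition prod_plus :: "nat set \<Rightarrow> real \<Rightarrow> real" where
  "prod_plus P z = (\<Prod>p | p \<in> P \<and> real p < z. 1 + 1 / real p)"

lemma finite_nat_less_real [simp]: "finite {p::nat. p \<in> P \<and> real p < z}"
  by (rule finite_subset[of _ "{..nat \<lceil>z\<rceil>}"]) (auto, linarith)

text \<open>Each summand is the drop of the partial product when \<open>p\<close> is appended. For
  \<open>f p = 1 / p\<close> this is Buchstab's identity for the density.\<close>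

lemma sum_telescope_prod:
  fixes f :: "nat \<Rightarrow> real"
  assumes "finite F"
  shows "(\<Sum>p\<in>F. f p * (\<Prod>r\<in>{r \<in> F. r < p}. 1 - f r)) = 1 - (\<Prod>p\<in>F. 1 - f p)"
  using assms
proof (induction F rule: finite_linorder_max_induct)
  case (insert b A)
  have "b \<notin> A" using insert by auto
  have "{r \<in> insert b A. r < b} = A" using insert by auto
  moreover have "{r \<in> insert b A. r < p} = {r \<in> A. r < p}" if "p \<in> A" for p
    using insert that by auto
  ultimately have "(\<Sum>p\<in>insert b A. f p * (\<Prod>r\<in>{r \<in> insert b A. r < p}. 1 - f r))
     = f b * (\<Prod>r\<in>A. 1 - f r) + (\<Sum>p\<in>A. f p * (\<Prod>r\<in>{r \<in> A. r < p}. 1 - f r))"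
    using insert \<open>b \<notin> A\<close> by (subst sum.insert) auto
  then show ?case using insert \<open>b \<notin> A\<close> by (simp add: algebra_simps)
qed simp

lemma filter_below: "p \<in> {p \<in> P. real p < z} \<Longrightarrow>
  {r \<in> {p \<in> P. real p < z}. r < p} = {r \<in> P. real r < real p}" for p :: nat
  by auto

lemma sum_prod_minus: "(\<Sum>p | p \<in> P \<and> real p < z. prod_minus P (real p) / real p) = 1 - prod_minus P z"
proof -
  have "(\<Sum>p | p \<in> P \<and> real p < z. prod_minus P (real p) / real p) =
     (\<Sum>p | p \<in> P \<and> real p < z. (1 / real p) * (\<Prod>r\<in>{r \<in> {p \<in> P. real p < z}. r < p}. 1 - 1 / real r))"
    by (rule sum.cong) (simp_all only: prod_minus_def filter_below, simp_all)
  then show ?thesis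
    by (subst (asm) sum_telescope_prod) (auto simp: prod_minus_def)
qed

lemma sum_prod_plus: "(\<Sum>p | p \<in> P \<and> real p < z. prod_plus P (real p) / real p) = prod_plus P z - 1"
proof -
  have "(\<Sum>p | p \<in> P \<and> real p < z. prod_plus P (real p) / real p) =
     - (\<Sum>p | p \<in> P \<and> real p < z. (- (1 / real p)) * (\<Prod>r\<in>{r \<in> {p \<in> P. real p < z}. r < p}. 1 - (- (1 / real r))))"
    unfolding sum_negf[symmetric] by (rule sum.cong) (simp_all only: prod_plus_def filter_below, simp_all)
  then show ?thesis
    by (subst (asm) sum_telescope_prod) (auto simp: prod_plus_def)
qed

text \<open>Joins the two regimes of the upper sieve bound. At \<open>s = 4\<close> the sides are
  \<open>1.1925\<close> and \<open>1.21875\<close>, so the expansion is made around this tight end,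
  with \<open>ln 4 >= 4/3\<close> and the quadratic Taylor bound.\<close>

lemma hyperbola_le_exponential:
  assumes "2 \<le> s" "s \<le> (4::real)"
  shows "4.77 / s \<le> 1 + 56 * 4 powr (-s)"
proof -
  define y where "y = 4 - s"
  have y: "0 \<le> y" "y \<le> 2" using assms by (auto simp: y_def)
  have "ln 4 = 2 * ln (2::real)" using ln_realpow[of 2 2] by simp
  then have l: "4 / 3 \<le> ln (4::real)" using ln2_ge_two_thirds by simp
  have "1 + 4/3 * y + (4/3 * y)\<^sup>2 / 2 \<le> exp (4/3 * y)"
    by (rule exp_lower_Taylor_quadratic) (use y in auto)
  also have "\<dots> \<le> exp (ln 4 * y)" using mult_right_mono[OF l y(1)] by simp
  also have "\<dots> = 4 powr y" by (simp add: powr_def mult.commute)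
  finally have e: "1 + 4/3 * y + 8/9 * y\<^sup>2 \<le> 4 powr y" by (simp add: power_mult_distrib field_simps)
  have "56 * 4 powr (-s) = 56 / 256 * 4 powr y"
    using powr_add[of 4 "-4" y] by (simp add: y_def powr_minus field_simps)
  also have "\<dots> \<ge> 56 / 256 * (1 + 4/3 * y + 8/9 * y\<^sup>2)" using e by simp
  finally have 1: "7 / 32 * (1 + 4/3 * y + 8/9 * y\<^sup>2) \<le> 56 * 4 powr (-s)" by simp
  have "0 \<le> (4 - y) * (1 + 7 / 32 * (1 + 4/3 * y + 8/9 * y\<^sup>2)) - 4.77"
  proof -
    have "(4 - y) * (1 + 7 / 32 * (1 + 4/3 * y + 8/9 * y\<^sup>2)) - 4.77
      = 21/200 - 5/96 * y + (7/9 - 7/24) * y\<^sup>2 - 7/36 * y^3"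
      by (simp add: field_simps power2_eq_square power3_eq_cube)
    moreover have "y^3 \<le> 2 * y\<^sup>2" using y mult_right_mono[of y 2 "y\<^sup>2"] by (simp add: power3_eq_cube power2_eq_square)
    moreover have "0 \<le> 21/200 - 5/96 * y + (7/9 - 7/24) * y\<^sup>2 - 7/36 * (2 * y\<^sup>2)"
    proof -
      \<comment> \<open>\<open>7/25\<close> approximates the minimiser \<open>15/56\<close> of the
        quadratic below.\<close>
      have "0 \<le> y\<^sup>2 - 14/25 * y + 49/625"
        using zero_le_power2[of "y - 7/25"] by (simp add: power2_eq_square field_simps)
      then have "0 \<le> 21 / 200 - 5/96 * y + 7/72 * y\<^sup>2" using y by linarith
      then show ?thesis by simp
    qed
    ultimately show ?thesis by linarith
  qed
  then have "4.77 \<le> s * (1 + 7 / 32 * (1 + 4/3 * y + 8/9 * y\<^sup>2))" by (simp add: y_def)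
  also have "\<dots> \<le> s * (1 + 56 * 4 powr (-s))" using 1 assms by (intro mult_left_mono) auto
  finally show ?thesis using assms by (simp add: field_simps)
qed

text \<open>Of the usual two-sided density hypothesis only the upper bound is required, so that discarding the
  primes that divide the modulus costs nothing.\<close>

locale linear_sieve =
  fixes A P :: "nat set" and X \<epsilon> :: real
  assumes finite_A [simp]: "finite A"
    and prime_P: "p \<in> P \<Longrightarrow> prime p"
    and X_nonneg: "0 \<le> X"
    and level: "d > 0 \<Longrightarrow> (\<And>p. prime p \<Longrightarrow> p dvd d \<Longrightarrow> p \<in> P) \<Longrightarrow>
       \<bar>real (card {n \<in> A. d dvd n}) - X / real d\<bar> \<le> 1"
    and eps: "0 \<le> \<epsilon>" "\<epsilon> \<le> 1 / 1000"
    and dimension: "1 < w \<Longrightarrow> w \<le> z \<Longrightarrow>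
       prod_minus P w \<le> (1 + \<epsilon>) * (ln z / ln w) * prod_minus P z"
begin

abbreviation "V \<equiv> prod_minus P"
abbreviation "W \<equiv> prod_plus P"

definition sifted :: "nat \<Rightarrow> real \<Rightarrow> nat set" where
  "sifted d z = {n \<in> A. d dvd n \<and> (\<forall>p\<in>P. real p < z \<longrightarrow> \<not> p dvd n)}"

text \<open>The modulus \<open>d\<close> collects the primes split off by earlier Buchstab steps.
  They lie at or above the current limit, so the next prime \<open>p < z\<close> is coprime to
  \<open>d\<close> and can become the new limit.\<close>

definition admissible :: "nat \<Rightarrow> real \<Rightarrow> bool" where
  "admissible d z \<longleftrightarrow> d > 0 \<and> (\<forall>p. prime p \<longrightarrow> p dvd d \<longrightarrow> p \<in> P \<and> z \<le> real p)"

lemma ge_2_P: "p \<in> P \<Longrightarrow> 2 \<le> p"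
  using prime_P prime_ge_2_nat by blast

lemma finite_sifted [simp]: "finite (sifted d z)"
  by (rule finite_subset[OF _ finite_A]) (auto simp: sifted_def)

lemma V_pos: "0 < V z"
  unfolding prod_minus_def by (rule prod_pos) (use ge_2_P in fastforce)

lemma W_ge_1: "1 \<le> W z"
  unfolding prod_plus_def by (rule prod_ge_1) auto

lemma W_mono: "w \<le> z \<Longrightarrow> W w \<le> W z"
  unfolding prod_plus_def by (rule prod_mono2) (auto intro: finite_nat_less_real)

text \<open>Together with \<open>V_lower_bound\<close> this makes the error factor at most
  logarithmic.\<close>

lemma W_le: "W z \<le> 1 / V z"
proof -
  have "W z \<le> (\<Prod>p | p \<in> P \<and> real p < z. 1 / (1 - 1 / real p))"
    unfolding prod_plus_def
  proof (rule prod_mono)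
    fix p assume "p \<in> {p \<in> P. real p < z}"
    then have "real p \<ge> 2" using ge_2_P by force
    then show "0 \<le> 1 + 1 / real p \<and> 1 + 1 / real p \<le> 1 / (1 - 1 / real p)"
      by (simp add: field_simps)
  qed
  then show ?thesis by (simp add: prod_minus_def prod_dividef)
qed

lemma dvd_mult_admissible:
  assumes "admissible d z" "p \<in> P" "real p < z"
  shows "p * d dvd n \<longleftrightarrow> d dvd n \<and> p dvd n"
proof -
  have "coprime p d"
    using assms prime_P[of p] by (intro prime_imp_coprime) (auto simp: admissible_def)
  then show ?thesis using divides_mult by (auto dest: dvd_mult_left dvd_mult_right)
qed

lemma admissible_mult:
  assumes "admissible d z" "p \<in> P" "real p < z"
  shows "admissible (p * d) (real p)"
  using assms prime_P[of p] ge_2_P[of p]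
  by (auto simp: admissible_def prime_dvd_mult_iff dest: primes_dvd_imp_eq)

text \<open>The multiples of \<open>d\<close> that fail to be sifted are classified by their least
  prime factor in \<open>P\<close>.\<close>

lemma buchstab:
  assumes "admissible d z"
  shows "real (card (sifted d z)) = real (card {n \<in> A. d dvd n}) -
    (\<Sum>p | p \<in> P \<and> real p < z. real (card (sifted (p * d) (real p))))"
proof -
  let ?P = "{p. p \<in> P \<and> real p < z}"
  have "{n \<in> A. d dvd n} = sifted d z \<union> (\<Union>p\<in>?P. sifted (p * d) (real p))"
  proof (intro equalityI subsetI)
    fix n assume n: "n \<in> {n \<in> A. d dvd n}"
    show "n \<in> sifted d z \<union> (\<Union>p\<in>?P. sifted (p * d) (real p))"
    proof (cases "\<exists>p. p \<in> P \<and> real p < z \<and> p dvd n")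
      case True
      define p where "p = (LEAST p. p \<in> P \<and> real p < z \<and> p dvd n)"
      have p: "p \<in> P \<and> real p < z \<and> p dvd n" unfolding p_def by (rule LeastI_ex[OF True])
      have "\<not> r dvd n" if "r \<in> P" "real r < real p" for r
        using not_less_Least[of r "\<lambda>p. p \<in> P \<and> real p < z \<and> p dvd n"] that p
        by (auto simp: p_def[symmetric])
      then have "n \<in> sifted (p * d) (real p)"
        using n p dvd_mult_admissible[OF assms, of p n] by (auto simp: sifted_def)
      then show ?thesis using p by auto
    qed (use n in \<open>auto simp: sifted_def\<close>)
  qed (auto simp: sifted_def dvd_mult_admissible[OF assms])
  moreover have "card (sifted d z \<union> (\<Union>p\<in>?P. sifted (p * d) (real p))) =
     card (sifted d z) + card (\<Union>p\<in>?P. sifted (p * d) (real p))"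
    by (rule card_Un_disjoint) (auto simp: sifted_def dvd_mult_admissible[OF assms])
  moreover have "card (\<Union>p\<in>?P. sifted (p * d) (real p)) = (\<Sum>p\<in>?P. card (sifted (p * d) (real p)))"
  proof (rule card_UN_disjoint)
    show "\<forall>i\<in>?P. \<forall>j\<in>?P. i \<noteq> j \<longrightarrow> sifted (i * d) (real i) \<inter> sifted (j * d) (real j) = {}"
    proof (intro ballI impI equals0I)
      fix i j n assume ij: "i \<in> ?P" "j \<in> ?P" "i \<noteq> j" "n \<in> sifted (i * d) (real i) \<inter> sifted (j * d) (real j)"
      then have "i dvd n" "j dvd n" by (auto simp: sifted_def dest: dvd_mult_left)
      then show False using ij by (cases "i < j") (auto simp: sifted_def)
    qed
  qed auto
  ultimately show ?thesis by simp
qed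

section \<open>Sums over primes against the density\<close>

text \<open>The condition on \<open>p\<close> says \<open>p >= w\<close> for
  \<open>w = D powr (1 / x)\<close>, so the sum telescopes to \<open>V w - V z\<close>, which the
  density hypothesis bounds.\<close>

lemma sum_V_segment:
  assumes "1 < z" "1 < D" "ln D / ln z \<le> x"
  shows "(\<Sum>p | p \<in> P \<and> real p < z \<and> ln D / ln (real p) \<le> x. V (real p) / real p)
     \<le> V z * ((1 + \<epsilon>) * (x / (ln D / ln z)) - 1)"
proof -
  define w where "w = exp (ln D / x)"
  have "0 < ln D / ln z" using assms by simp
  then have x: "0 < x" using assms(3) by linarith
  then have w: "1 < w" "ln w = ln D / x" using assms by (auto simp: w_def)
  have "ln w \<le> ln z" unfolding w(2) using assms x by (simp add: field_simps)
  then have wz: "w \<le> z" using w(1) assms(1,2) ln_le_cancel_iff[of w z] by linarith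
  have eq: "{p. p \<in> P \<and> real p < z} = {p. p \<in> P \<and> real p < w} \<union> {p. p \<in> P \<and> real p < z \<and> ln D / ln (real p) \<le> x}"
  proof -
    have "ln D / ln (real p) \<le> x \<longleftrightarrow> w \<le> real p" if "p \<in> P" for p
    proof -
      have p: "real p > 1" using ge_2_P[OF that] by simp
      then have "w \<le> real p \<longleftrightarrow> ln w \<le> ln (real p)" using w(1) by simp
      also have "\<dots> \<longleftrightarrow> ln D / ln (real p) \<le> x" unfolding w using p x by (simp add: field_simps)
      finally show ?thesis by simp
    qed
    then show ?thesis using wz by auto
  qed
  have dis: "{p. p \<in> P \<and> real p < w} \<inter> {p. p \<in> P \<and> real p < z \<and> ln D / ln (real p) \<le> x} = {}"
  proof (intro equals0I)
    fix p assume p: "p \<in> {p. p \<in> P \<and> real p < w} \<inter> {p. p \<in> P \<and> real p < z \<and> ln D / ln (real p) \<le> x}"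
    then have p1: "real p > 1" using ge_2_P[of p] by auto
    then have "ln (real p) < ln w" using p w(1) by auto
    then show False using p p1 x unfolding w by (auto simp: field_simps)
  qed
  have "1 - V z = (\<Sum>p | p \<in> P \<and> real p < z. V (real p) / real p)" by (rule sum_prod_minus[symmetric])
  also have "\<dots> = (\<Sum>p | p \<in> P \<and> real p < w. V (real p) / real p) +
    (\<Sum>p | p \<in> P \<and> real p < z \<and> ln D / ln (real p) \<le> x. V (real p) / real p)"
    unfolding eq
    by (rule sum.union_disjoint) (use dis in \<open>auto intro: finite_subset[OF _ finite_nat_less_real[of P z]]\<close>)
  also have "(\<Sum>p | p \<in> P \<and> real p < w. V (real p) / real p) = 1 - V w" by (rule sum_prod_minus)
  finally have "(\<Sum>p | p \<in> P \<and> real p < z \<and> ln D / ln (real p) \<le> x. V (real p) / real p) = V w - V z" by simp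
  also have "\<dots> \<le> (1 + \<epsilon>) * (ln z / ln w) * V z - V z" using dimension[OF w(1) wz] by simp
  also have "ln z / ln w = x / (ln D / ln z)" using w by simp
  finally show ?thesis by (simp add: algebra_simps)
qed

text \<open>\<open>3 / 4\<close> is an upper bound for \<open>1 / ln 4\<close>, so \<open>1 + \<kappa> s\<close> dominates
  \<open>(1 + \<epsilon>) / s\<close> times the integral of \<open>ln 4 * x * 4 powr (s - x)\<close> over \<open>x \<ge> s\<close>.\<close>

definition \<kappa> :: "real \<Rightarrow> real" where
  "\<kappa> s = (1 + \<epsilon>) * (1 + 3 / (4 * s)) - 1"

text \<open>Layer-cake summation: \<open>4 powr (- u)\<close> is the integral of
  \<open>ln 4 * 4 powr (- x)\<close> over \<open>x >= u\<close>, so the sum becomes an integral over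
  segment sums, which are bounded by a linear function of \<open>x\<close>.\<close>

lemma sum_V_exponential:
  assumes "1 < z" "1 < D"
  shows "(\<Sum>p | p \<in> P \<and> real p < z. V (real p) / real p * 4 powr (- (ln D / ln (real p))))
     \<le> V z * (4 powr (- (ln D / ln z)) * \<kappa> (ln D / ln z))"
proof -
  define s where "s = ln D / ln z"
  define u where "u = (\<lambda>p::nat. ln D / ln (real p))"
  let ?P = "{p. p \<in> P \<and> real p < z}"
  define c where "c = (\<lambda>p::nat. V (real p) / real p)"
  \<comment> \<open>A crude bound for every \<open>u p\<close>, which keeps the integrals on a
    compact interval; \<open>G\<close> is an antiderivative of the integrand given by the segment
    bound, up to the factor \<open>V z\<close>.\<close>
  define K where "K = s + (\<Sum>p\<in>?P. u p)"
  define G where "G = (\<lambda>x. - (4 powr (-x)) * ((1 + \<epsilon>) * (x + 1 / ln 4) / s - 1))"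
  have s: "s > 0" using assms by (simp add: s_def)
  have c: "c p \<ge> 0" for p using V_pos[of "real p"] by (simp add: c_def)
  have u0: "0 \<le> u p" if "p \<in> P" for p
    using ge_2_P[OF that] assms by (auto simp: u_def)
  have u: "s \<le> u p" "u p \<le> K" if "p \<in> ?P" for p
  proof -
    have p: "1 < real p" "real p < z" using that ge_2_P[of p] by auto
    then show "s \<le> u p" unfolding s_def u_def using assms by (intro divide_left_mono) auto
    have "u p \<le> (\<Sum>p\<in>?P. u p)"
      by (rule member_le_sum) (use that u0 in auto)
    then show "u p \<le> K" using s by (simp add: K_def)
  qed
  have sK: "s \<le> K"
    unfolding K_def using u0 by (auto intro!: sum_nonneg)
  have seg: "(\<Sum>p | p \<in> ?P \<and> u p \<le> x. c p) \<le> V z * ((1 + \<epsilon>) * (x / s) - 1)" if "s \<le> x" for x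
    using sum_V_segment[OF assms, of x] that by (simp add: s_def u_def c_def conj_assoc)
  have deriv: "((\<lambda>x. 4 powr (-x)) has_real_derivative (- (ln 4 * 4 powr (-x)))) (at x within S)" for x :: real and S
    unfolding powr_def by (auto intro!: derivative_eq_intros)
  have I1: "((\<lambda>x. if u p \<le> x then ln 4 * 4 powr (-x) else 0) has_integral (4 powr (- u p) - 4 powr (-K))) {s..K}"
    if "p \<in> ?P" for p
  proof -
    have "((\<lambda>x. ln 4 * 4 powr (-x)) has_integral (- (4 powr (-K)) - (- (4 powr (- u p))))) {u p..K}"
      by (rule fundamental_theorem_of_calculus)
        (use u that in \<open>auto intro!: derivative_eq_intros deriv simp flip: has_real_derivative_iff_has_vector_derivative\<close>)
    then have "((\<lambda>x. if x \<in> {u p..K} then ln 4 * 4 powr (-x) else 0) has_integral (- (4 powr (-K)) - (- (4 powr (- u p))))) {s..K}"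
      by (subst has_integral_restrict) (use u[OF that] in auto)
    then show ?thesis
      by (rule has_integral_eq_rhs[OF has_integral_eq, rotated]) auto
  qed
  have I2: "((\<lambda>x. V z * (ln 4 * 4 powr (-x) * ((1 + \<epsilon>) * (x / s) - 1))) has_integral (V z * (G K - G s))) {s..K}"
    unfolding G_def
    by (intro has_integral_mult_right fundamental_theorem_of_calculus)
       (use s sK in \<open>auto intro!: derivative_eq_intros deriv simp: field_simps simp flip: has_real_derivative_iff_has_vector_derivative\<close>)
  have "(\<Sum>p\<in>?P. c p * (4 powr (- u p) - 4 powr (-K))) \<le> V z * (G K - G s)"
  proof (rule has_integral_le)
    show "((\<lambda>x. \<Sum>p\<in>?P. c p * (if u p \<le> x then ln 4 * 4 powr (-x) else 0)) has_integral
      (\<Sum>p\<in>?P. c p * (4 powr (- u p) - 4 powr (-K)))) {s..K}"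
      by (intro has_integral_sum has_integral_mult_right I1) auto
    show "((\<lambda>x. V z * (ln 4 * 4 powr (-x) * ((1 + \<epsilon>) * (x / s) - 1))) has_integral (V z * (G K - G s))) {s..K}"
      by (rule I2)
    fix x assume x: "x \<in> {s..K}"
    have "(\<Sum>p\<in>?P. c p * (if u p \<le> x then ln 4 * 4 powr (-x) else 0))
       = (ln 4 * 4 powr (-x)) * (\<Sum>p | p \<in> ?P \<and> u p \<le> x. c p)"
      unfolding sum_distrib_left by (rule sum.mono_neutral_cong_right) auto
    also have "\<dots> \<le> (ln 4 * 4 powr (-x)) * (V z * ((1 + \<epsilon>) * (x / s) - 1))"
      by (rule mult_left_mono) (use seg x in auto)
    finally show "(\<Sum>p\<in>?P. c p * (if u p \<le> x then ln 4 * 4 powr (-x) else 0)) \<le> V z * (ln 4 * 4 powr (-x) * ((1 + \<epsilon>) * (x / s) - 1))"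
      by (simp add: mult_ac)
  qed
  moreover have "(\<Sum>p\<in>?P. c p) \<le> V z * ((1 + \<epsilon>) * (K / s) - 1)"
  proof -
    have "{p \<in> ?P. u p \<le> K} = ?P" using u by auto
    then show ?thesis using seg[OF sK] by simp
  qed
  then have "4 powr (-K) * (\<Sum>p\<in>?P. c p) \<le> 4 powr (-K) * (V z * ((1 + \<epsilon>) * (K / s) - 1))"
    by (rule mult_left_mono) auto
  moreover have "(\<Sum>p\<in>?P. c p * (4 powr (- u p) - 4 powr (-K))) =
      (\<Sum>p\<in>?P. c p * 4 powr (- u p)) - 4 powr (-K) * (\<Sum>p\<in>?P. c p)"
    by (simp add: algebra_simps sum_subtractf sum_distrib_left)
  \<comment> \<open>The terms created by truncating at \<open>K\<close> cancel up to a nonpositive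
    remainder.\<close>
  moreover have "4 powr (-K) * (V z * ((1 + \<epsilon>) * (K / s) - 1)) + V z * G K \<le> 0"
  proof -
    have "4 powr (-K) * (V z * ((1 + \<epsilon>) * (K / s) - 1)) + V z * G K
      = - (V z * 4 powr (-K) * ((1 + \<epsilon>) / (ln 4 * s)))"
      using s by (simp add: G_def field_simps)
    also have "\<dots> \<le> 0" using V_pos[of z] eps s by simp
    finally show ?thesis .
  qed
  moreover have "- G s \<le> 4 powr (-s) * \<kappa> s"
  proof -
    have "ln 4 = 2 * ln (2::real)" using ln_realpow[of 2 2] by simp
    then have "ln 4 \<ge> (4/3::real)" using ln2_ge_two_thirds by simp
    then have "1 / ln 4 \<le> (3/4::real)" by (simp add: field_simps)
    then have "(1 + \<epsilon>) * (s + 1 / ln 4) \<le> (1 + \<epsilon>) * (s + 3 / 4)" using eps by (intro mult_left_mono) auto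
    then have "(1 + \<epsilon>) * (s + 1 / ln 4) / s \<le> (1 + \<epsilon>) * (s + 3 / 4) / s" using s by (intro divide_right_mono) auto
    also have "\<dots> = \<kappa> s + 1" using s by (simp add: \<kappa>_def field_simps)
    finally show ?thesis unfolding G_def by simp
  qed
  then have "V z * (- G s) \<le> V z * (4 powr (-s) * \<kappa> s)" using V_pos[of z] by (intro mult_left_mono) auto
  ultimately have "(\<Sum>p\<in>?P. c p * 4 powr (- u p)) \<le> V z * (4 powr (-s) * \<kappa> s)"
    by (simp add: algebra_simps)
  then show ?thesis by (simp add: c_def u_def s_def)
qed

text \<open>In the following bounds \<open>D\<close> is the level and \<open>s = ln D / ln z\<close> the sieving parameter. The functions
  \<open>4 powr (3 - s)\<close> and \<open>56 * 4 powr (- s)\<close> are not optimal, but they reproduce themselves under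
  Buchstab's identity with room to spare, which absorbs \<open>\<epsilon>\<close>. Multiplying the error \<open>D\<close> by
  \<open>W z\<close> makes it telescope as well.\<close>

definition lower_at :: "real \<Rightarrow> bool" where
  "lower_at z \<longleftrightarrow> (\<forall>d D. admissible d z \<longrightarrow> 1 \<le> D \<longrightarrow> 3 \<le> ln D / ln z \<longrightarrow>
     X / real d * V z * (1 - 4 powr (3 - ln D / ln z)) - D * W z \<le> real (card (sifted d z)))"

definition upper_at :: "real \<Rightarrow> bool" where
  "upper_at z \<longleftrightarrow> (\<forall>d D. admissible d z \<longrightarrow> 1 \<le> D \<longrightarrow> 2 \<le> ln D / ln z \<longrightarrow>
     real (card (sifted d z)) \<le> X / real d * V z * (1 + 56 * 4 powr (- (ln D / ln z))) + D * W z)"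

text \<open>The direct output of one Buchstab step. At \<open>s = 4\<close> its factor
  \<open>1 + \<kappa> 4\<close> is smaller than the \<open>1 + 56/256\<close> of
  \<open>upper_at\<close>, and the constant \<open>4.77\<close> depends on that.\<close>

definition strong_upper_at :: "real \<Rightarrow> bool" where
  "strong_upper_at z \<longleftrightarrow> (\<forall>d D. admissible d z \<longrightarrow> 1 \<le> D \<longrightarrow> 4 \<le> ln D / ln z \<longrightarrow>
     real (card (sifted d z)) \<le> X / real d * V z * (1 + 4 powr (4 - ln D / ln z) * \<kappa> (ln D / ln z)) + D * W z)"

lemma level_admissible:
  assumes "admissible d z"
  shows "\<bar>real (card {n \<in> A. d dvd n}) - X / real d\<bar> \<le> 1"
  using assms by (intro level) (auto simp: admissible_def)

lemma ln_div_ratio: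
  assumes "1 \<le> D" "p \<in> P"
  shows "ln (D / real p) / ln (real p) = ln D / ln (real p) - 1"
  using assms ge_2_P[of p] by (simp add: ln_div diff_divide_distrib)

lemma level_ge_power:
  assumes "1 \<le> D" "real k \<le> ln D / ln z" "1 < z"
  shows "z ^ k \<le> D"
proof -
  have "ln (z ^ k) \<le> ln D" using assms by (simp add: ln_realpow field_simps)
  then show ?thesis using assms by simp
qed

section \<open>The simultaneous induction on Buchstab's identity\<close>

text \<open>The lower bound is inserted with level \<open>D / p\<close>, which lowers each parameter
  \<open>u\<close> by one: from at least 4 to at least 3. The factor 256 is
  \<open>4 powr (3 - (u - 1))\<close> divided by \<open>4 powr (- u)\<close>.\<close>

lemma strong_upper_step:
  assumes "\<And>p. p \<in> P \<Longrightarrow> real p < z \<Longrightarrow> lower_at (real p)" "1 < z"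
  shows "strong_upper_at z"
  unfolding strong_upper_at_def
proof (intro allI impI)
  fix d D assume adm: "admissible d z" and D1: "1 \<le> D" and s4: "4 \<le> ln D / ln z"
  let ?P = "{p. p \<in> P \<and> real p < z}"
  define s where "s = ln D / ln z"
  have Dz: "z ^ 4 \<le> D" using level_ge_power[of D 4 z] D1 s4 assms by simp
  have D: "1 < D" using Dz one_less_power[of z 4] assms by linarith
  have d: "d > 0" using adm by (simp add: admissible_def)
  have low: "X / real d * (V p / real p) - 256 * (X / real d) * (V p / real p * 4 powr (- (ln D / ln p))) - D * (W p / real p)
      \<le> real (card (sifted (p * d) (real p)))" if "p \<in> ?P" for p :: nat
  proof -
    have p: "p \<in> P" "real p < z" "2 \<le> p" using that ge_2_P by auto
    have "real p \<le> z ^ 4"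
      using p assms by (intro less_imp_le[OF less_le_trans[OF p(2)]]) (auto intro: self_le_power)
    then have 1: "1 \<le> D / real p" using Dz p by (simp add: field_simps)
    have "s \<le> ln D / ln (real p)"
      unfolding s_def using p D assms by (intro divide_left_mono) auto
    then have "3 \<le> ln (D / real p) / ln (real p)"
      unfolding ln_div_ratio[OF D1 p(1)] using s4 by (simp add: s_def)
    with assms(1)[OF p(1,2)] admissible_mult[OF adm p(1,2)] 1
    have *: "X / real (p * d) * V p * (1 - 4 powr (3 - ln (D / real p) / ln (real p))) - D / real p * W p
      \<le> real (card (sifted (p * d) (real p)))"
      unfolding lower_at_def by blast
    have "4 powr (3 - ln (D / real p) / ln (real p)) = 256 * 4 powr (- (ln D / ln p))"
      unfolding ln_div_ratio[OF D1 p(1)] using powr_add[of 4 4 "- (ln D / ln p)"] by simp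
    then show ?thesis using * p d by (simp add: field_simps)
  qed
  have "real (card (sifted d z)) = real (card {n \<in> A. d dvd n}) -
    (\<Sum>p\<in>?P. real (card (sifted (p * d) (real p))))" by (rule buchstab[OF adm])
  also have "\<dots> \<le> (X / real d + 1) - (\<Sum>p\<in>?P. X / real d * (V p / real p) - 256 * (X / real d) * (V p / real p * 4 powr (- (ln D / ln p))) - D * (W p / real p))"
    by (intro diff_mono sum_mono low) (use level_admissible[OF adm] in auto)
  also have "\<dots> = (X / real d + 1) - X / real d * (\<Sum>p\<in>?P. V p / real p)
     + 256 * (X / real d) * (\<Sum>p\<in>?P. V p / real p * 4 powr (- (ln D / ln p))) + D * (\<Sum>p\<in>?P. W p / real p)"
    by (simp add: sum_subtractf sum_distrib_left)
  also have "\<dots> \<le> (X / real d + 1) - X / real d * (1 - V z)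
     + 256 * (X / real d) * (V z * (4 powr (-s) * \<kappa> s)) + D * (W z - 1)"
    unfolding sum_prod_minus sum_prod_plus s_def
    by (intro add_mono mult_left_mono sum_V_exponential order_refl) (use assms D X_nonneg in auto)
  \<comment> \<open>The leading term has error 1 and the subtracted ones
    \<open>D * (W z - 1)\<close> in total; as \<open>1 <= D\<close>, together they stay below
    \<open>D * W z\<close>.\<close>
  also have "\<dots> = X / real d * V z * (1 + 256 * 4 powr (-s) * \<kappa> s) + D * W z + (1 - D)"
    by (simp add: algebra_simps)
  also have "256 * 4 powr (-s) = 4 powr (4 - s)" using powr_add[of 4 4 "-s"] by simp
  finally show "real (card (sifted d z)) \<le> X / real d * V z * (1 + 4 powr (4 - ln D / ln z) * \<kappa> (ln D / ln z)) + D * W z"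
    using D1 by (simp add: s_def)
qed

lemma \<kappa>_antimono: "0 < s \<Longrightarrow> s \<le> t \<Longrightarrow> \<kappa> t \<le> \<kappa> s"
  unfolding \<kappa>_def using eps by (intro diff_mono mult_left_mono add_mono divide_left_mono) auto

text \<open>The mirror image of \<open>strong_upper_step\<close>: the shift by one turns 56 into
  224, and the bound reproduces itself because \<open>224 * \<kappa> 3\<close> is at most about
  56.3, below \<open>64 = 4 ^ 3\<close>.\<close>

lemma lower_step:
  assumes "\<And>p. p \<in> P \<Longrightarrow> real p < z \<Longrightarrow> upper_at (real p)" "1 < z"
  shows "lower_at z"
  unfolding lower_at_def
proof (intro allI impI)
  fix d D assume adm: "admissible d z" and D1: "1 \<le> D" and s3: "3 \<le> ln D / ln z"
  let ?P = "{p. p \<in> P \<and> real p < z}"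
  define s where "s = ln D / ln z"
  have Dz: "z ^ 3 \<le> D" using level_ge_power[of D 3 z] D1 s3 assms by simp
  have D: "1 < D" using Dz one_less_power[of z 3] assms by linarith
  have d: "d > 0" using adm by (simp add: admissible_def)
  have up: "real (card (sifted (p * d) (real p))) \<le> X / real d * (V p / real p) + 224 * (X / real d) * (V p / real p * 4 powr (- (ln D / ln p))) + D * (W p / real p)"
    if "p \<in> ?P" for p :: nat
  proof -
    have p: "p \<in> P" "real p < z" "2 \<le> p" using that ge_2_P by auto
    have "real p \<le> z ^ 3"
      using p assms by (intro less_imp_le[OF less_le_trans[OF p(2)]]) (auto intro: self_le_power)
    then have 1: "1 \<le> D / real p" using Dz p by (simp add: field_simps)
    have "s \<le> ln D / ln (real p)"
      unfolding s_def using p D assms by (intro divide_left_mono) auto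
    then have "2 \<le> ln (D / real p) / ln (real p)"
      unfolding ln_div_ratio[OF D1 p(1)] using s3 by (simp add: s_def)
    with assms(1)[OF p(1,2)] admissible_mult[OF adm p(1,2)] 1
    have *: "real (card (sifted (p * d) (real p))) \<le>
      X / real (p * d) * V p * (1 + 56 * 4 powr (- (ln (D / real p) / ln (real p)))) + D / real p * W p"
      unfolding upper_at_def by blast
    have "4 powr (- (ln (D / real p) / ln (real p))) = 4 * 4 powr (- (ln D / ln p))"
      unfolding ln_div_ratio[OF D1 p(1)] using powr_add[of 4 1 "- (ln D / ln p)"] by simp
    then show ?thesis using * p d by (simp add: field_simps)
  qed
  have "\<kappa> s \<le> \<kappa> 3" by (rule \<kappa>_antimono) (use s3 in \<open>auto simp: s_def\<close>)
  also have "\<dots> \<le> 64 / 224" using eps by (simp add: \<kappa>_def)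
  finally have \<kappa>: "\<kappa> s \<le> 64 / 224" .
  have "X / real d * V z * (1 - 4 powr (3 - s)) - D * W z
     \<le> X / real d * V z * (1 - 224 * (4 powr (-s) * \<kappa> s)) - D * W z + (D - 1)"
  proof -
    have "4 powr (3 - s) = 224 * (4 powr (-s) * (64 / 224))" using powr_add[of 4 3 "-s"] by simp
    also have "\<dots> \<ge> 224 * (4 powr (-s) * \<kappa> s)" using \<kappa> by (intro mult_left_mono) auto
    finally have "X / real d * V z * (1 - 4 powr (3 - s)) \<le> X / real d * V z * (1 - 224 * (4 powr (-s) * \<kappa> s))"
      using X_nonneg V_pos[of z] by (intro mult_left_mono) auto
    then show ?thesis using D1 by simp
  qed
  also have "\<dots> = (X / real d - 1) - (X / real d * (1 - V z)
     + 224 * (X / real d) * (V z * (4 powr (-s) * \<kappa> s)) + D * (W z - 1))"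
    by (simp add: algebra_simps)
  also have "\<dots> \<le> (X / real d - 1) - (X / real d * (\<Sum>p\<in>?P. V p / real p)
     + 224 * (X / real d) * (\<Sum>p\<in>?P. V p / real p * 4 powr (- (ln D / ln p))) + D * (\<Sum>p\<in>?P. W p / real p))"
    unfolding sum_prod_minus sum_prod_plus s_def
    by (intro diff_mono add_mono mult_left_mono sum_V_exponential order_refl) (use assms D X_nonneg in auto)
  also have "\<dots> = (X / real d - 1) - (\<Sum>p\<in>?P. X / real d * (V p / real p) + 224 * (X / real d) * (V p / real p * 4 powr (- (ln D / ln p))) + D * (W p / real p))"
    by (simp add: sum.distrib sum_distrib_left)
  also have "\<dots> \<le> real (card {n \<in> A. d dvd n}) - (\<Sum>p\<in>?P. real (card (sifted (p * d) (real p))))"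
    by (intro diff_mono sum_mono up) (use level_admissible[OF adm] in auto)
  also have "\<dots> = real (card (sifted d z))" by (rule buchstab[OF adm, symmetric])
  finally show "X / real d * V z * (1 - 4 powr (3 - ln D / ln z)) - D * W z \<le> real (card (sifted d z))"
    by (simp add: s_def)
qed

lemma sifted_antimono: "w \<le> z \<Longrightarrow> sifted d z \<subseteq> sifted d w"
  by (auto simp: sifted_def)

text \<open>Below \<open>s = 4\<close> one sieves only by the primes up to \<open>D powr (1/4)\<close>; the constant is
  \<open>4 * (1 + \<epsilon>) * (1 + \<kappa> 4)\<close>.\<close>

lemma upper_small:
  assumes "\<And>w. 1 < w \<Longrightarrow> w \<le> z \<Longrightarrow> strong_upper_at w"
    and "1 < z" "admissible d z" "1 < D" "ln D / ln z \<le> 4"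
  shows "real (card (sifted d z)) \<le> X / real d * V z * (4.77 * (ln z / ln D)) + D * W z"
proof -
  define w where "w = exp (ln D / 4)"
  have w: "1 < w" "ln w = ln D / 4" using assms by (auto simp: w_def)
  have "ln w \<le> ln z" unfolding w using assms by (simp add: field_simps)
  then have wz: "w \<le> z" using w(1) assms(1,2) ln_le_cancel_iff[of w z] by linarith
  have r: "ln D / ln w = 4" using w assms by (simp add: field_simps)
  have adm: "admissible d w" using assms wz by (auto simp: admissible_def)
  have d: "d > 0" using assms by (simp add: admissible_def)
  have k4: "1 + \<kappa> 4 \<le> 1.1887" using eps by (simp add: \<kappa>_def)
  have "real (card (sifted d z)) \<le> real (card (sifted d w))"
    by (simp add: card_mono sifted_antimono[OF wz])
  also have "\<dots> \<le> X / real d * V w * (1 + 4 powr (4 - ln D / ln w) * \<kappa> (ln D / ln w)) + D * W w"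
    using assms(1)[OF w(1) wz, unfolded strong_upper_at_def, rule_format, of d D] adm assms(4) r by simp
  also have "\<dots> = X / real d * V w * (1 + \<kappa> 4) + D * W w" unfolding r by simp
  also have "\<dots> \<le> X / real d * V w * 1.1887 + D * W z"
    by (intro add_mono mult_left_mono k4 W_mono wz) (use assms X_nonneg V_pos[of w] in auto)
  also have "V w \<le> (1 + \<epsilon>) * (ln z / ln w) * V z" by (rule dimension[OF w(1) wz])
  also have "ln z / ln w = 4 * (ln z / ln D)" unfolding w by simp
  also have "(1 + \<epsilon>) * (4 * (ln z / ln D)) * V z \<le> 1.001 * (4 * (ln z / ln D)) * V z"
    by (intro mult_right_mono) (use eps assms V_pos[of z] in auto)
  finally have "real (card (sifted d z)) \<le> X / real d * (1.001 * (4 * (ln z / ln D)) * V z) * 1.1887 + D * W z"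
    using X_nonneg by (simp add: mult_left_mono mult_right_mono divide_right_mono)
  also have "X / real d * (1.001 * (4 * (ln z / ln D)) * V z) * 1.1887 = X / real d * V z * (1.001 * 4 * 1.1887 * (ln z / ln D))"
    by (simp add: field_simps)
  also have "\<dots> \<le> X / real d * V z * (4.77 * (ln z / ln D))"
    by (intro mult_left_mono mult_right_mono) (use assms X_nonneg V_pos[of z] in auto)
  finally show ?thesis by simp
qed

lemma upper_step:
  assumes "\<And>w. 1 < w \<Longrightarrow> w \<le> z \<Longrightarrow> strong_upper_at w" "1 < z"
  shows "upper_at z"
  unfolding upper_at_def
proof (intro allI impI)
  fix d D assume adm: "admissible d z" and D1: "1 \<le> D" and s2: "2 \<le> ln D / ln z"
  define s where "s = ln D / ln z"
  have "z ^ 2 \<le> D" using level_ge_power[of D 2 z] D1 s2 assms by simp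
  then have D: "1 < D" using one_less_power[of z 2] assms by linarith
  show "real (card (sifted d z)) \<le> X / real d * V z * (1 + 56 * 4 powr (- (ln D / ln z))) + D * W z"
  proof (cases "s \<le> 4")
    case True
    have "real (card (sifted d z)) \<le> X / real d * V z * (4.77 / s) + D * W z"
      using upper_small[OF assms adm D] True by (simp add: s_def)
    also have "\<dots> \<le> X / real d * V z * (1 + 56 * 4 powr (-s)) + D * W z"
      by (intro add_mono mult_left_mono hyperbola_le_exponential)
        (use D1 True s2 X_nonneg V_pos[of z] in \<open>auto simp: s_def\<close>)
    finally show ?thesis by (simp add: s_def)
  next
    case False
    have "real (card (sifted d z)) \<le> X / real d * V z * (1 + 4 powr (4 - s) * \<kappa> s) + D * W z"
      using assms(1)[of z] assms(2) adm D1 False unfolding strong_upper_at_def s_def by simp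
    also have "\<dots> \<le> X / real d * V z * (1 + 56 * 4 powr (-s)) + D * W z"
    proof -
      have "\<kappa> s \<le> \<kappa> 4" by (rule \<kappa>_antimono) (use False in auto)
      also have "\<dots> \<le> 56 / 256" using eps by (simp add: \<kappa>_def)
      finally have "4 powr (4 - s) * \<kappa> s \<le> 4 powr (4 - s) * (56 / 256)" by (intro mult_left_mono) auto
      also have "\<dots> = 56 * 4 powr (-s)" using powr_add[of 4 4 "-s"] by simp
      finally show ?thesis
        by (intro add_mono mult_left_mono) (use D1 X_nonneg V_pos[of z] in auto)
    qed
    finally show ?thesis by (simp add: s_def)
  qed
qed

text \<open>The mutual dependence is well-founded: bounds at primes below \<open>p\<close> give the
  strong upper bound for every real limit up to \<open>p\<close>, which in turn gives
  \<open>upper_at\<close> at \<open>p\<close>.\<close>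

lemma bounds_below:
  "\<forall>p. p \<in> P \<longrightarrow> real p < z \<longrightarrow> lower_at (real p) \<and> upper_at (real p)"
proof (intro allI impI)
  fix p assume "p \<in> P" "real p < z"
  then show "lower_at (real p) \<and> upper_at (real p)"
  proof (induction p rule: less_induct)
    case (less p)
    have IH: "lower_at (real r) \<and> upper_at (real r)" if "r \<in> P" "real r < real p" for r
      using less that by auto
    have p: "1 < real p" using ge_2_P[OF less.prems(1)] by simp
    have "strong_upper_at w" if "1 < w" "w \<le> real p" for w
      by (rule strong_upper_step) (use IH that in auto)
    then show ?case using lower_step[OF _ p] upper_step[OF _ p] IH by blast
  qed
qed

lemma lower_bound:
  assumes "1 < z" "admissible d z" "1 \<le> D" "3 \<le> ln D / ln z"
  shows "X / real d * V z * (1 - 4 powr (3 - ln D / ln z)) - D * W z \<le> real (card (sifted d z))"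
  using lower_step[of z] bounds_below[of z] assms unfolding lower_at_def by blast

lemma upper_bound:
  assumes "1 < z" "admissible d z" "1 < D" "ln D / ln z \<le> 4"
  shows "real (card (sifted d z)) \<le> X / real d * V z * (4.77 * (ln z / ln D)) + D * W z"
proof (rule upper_small[OF _ assms])
  show "strong_upper_at w" if "1 < w" "w \<le> z" for w
    by (rule strong_upper_step) (use bounds_below[of w] that in auto)
qed

end

section \<open>Richert weights\<close>

lemma prod_minus_split:
  assumes "w \<le> z"
  shows "prod_minus P z = prod_minus P w * (\<Prod>p | p \<in> P \<and> w \<le> real p \<and> real p < z. 1 - 1 / real p)"
proof -
  have "{p \<in> P. real p < z} = {p \<in> P. real p < w} \<union> {p \<in> P. w \<le> real p \<and> real p < z}"
    using assms by auto
  then show ?thesis unfolding prod_minus_def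
    by (simp only:) (rule prod.union_disjoint, auto intro: finite_subset[OF _ finite_nat_less_real[of P z]])
qed

text \<open>As \<open>m\<close> is invertible modulo \<open>d\<close>, one residue class of
  \<open>j\<close> is selected, and it meets each block of \<open>d\<close> consecutive indices
  once.\<close>

lemma card_dvd_progression:
  fixes d m J :: nat
  assumes "coprime d m" "d > 0"
  shows "\<bar>real (card {j \<in> {1..J}. d dvd 1 + m * j}) - real J / real d\<bar> \<le> 1"
proof -
  obtain x where x: "[m * x = Suc 0] (mod d)"
    using cong_solve_coprime_nat[of m d] assms by (auto simp: coprime_commute)
  \<comment> \<open>\<open>(d - 1) * x\<close> represents minus the inverse of \<open>m\<close> by a
    natural number.\<close>
  define r where "r = ((d - 1) * x) mod d"
  have "d dvd 1 + m * ((d - 1) * x)"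
  proof -
    have "[m * x * (d - 1) + 1 = Suc 0 * (d - 1) + 1] (mod d)"
      by (intro cong_add cong_mult x cong_refl)
    then have "[1 + m * ((d - 1) * x) = 0] (mod d)"
      using assms by (simp add: mult_ac cong_def)
    then show ?thesis by (simp add: cong_0_iff)
  qed
  then have r0: "[1 + m * ((d - 1) * x) = 0] (mod d)" by (simp add: cong_0_iff)
  have iff: "d dvd 1 + m * j \<longleftrightarrow> j mod d = r" for j
  proof -
    have "d dvd 1 + m * j \<longleftrightarrow> [1 + m * j = 1 + m * ((d - 1) * x)] (mod d)"
      using r0 by (metis cong_0_iff cong_sym cong_trans)
    also have "\<dots> \<longleftrightarrow> [j = (d - 1) * x] (mod d)"
      using assms by (simp only: cong_add_lcancel_nat cong_mult_lcancel_nat coprime_commute)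
    finally show ?thesis by (simp add: cong_def r_def)
  qed
  let ?S = "{j \<in> {1..J}. j mod d = r}"
  have "card ?S \<le> card {0..J div d}"
  proof (rule card_inj_on_le)
    show "inj_on (\<lambda>j. j div d) ?S"
      by (rule inj_onI) (metis (mono_tags, lifting) div_mult_mod_eq mem_Collect_eq)
  qed (auto intro: div_le_mono)
  then have up: "card ?S \<le> J div d + 1" by simp
  have "card {0..<J div d} \<le> card ?S"
  proof (rule card_inj_on_le)
    \<comment> \<open>The indices start at 1, so the class of 0 is represented by
      \<open>d\<close>.\<close>
    define s where "s = (if r = 0 then d else r)"
    have s: "1 \<le> s" "s \<le> d" "s mod d = r"
      using assms by (auto simp: s_def r_def intro: less_imp_le)
    show "inj_on (\<lambda>i. i * d + s) {0..<J div d}" using assms by (auto simp: inj_on_def)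
    have "i * d + s \<le> J" if "i < J div d" for i
    proof -
      have "(i + 1) * d \<le> J div d * d" using that by (intro mult_right_mono) auto
      also have "\<dots> \<le> J" by simp
      finally show ?thesis using s by simp
    qed
    then show "(\<lambda>i. i * d + s) ` {0..<J div d} \<subseteq> ?S" using s by (auto simp: mod_add_left_eq)
  qed auto
  then have lo: "J div d \<le> card ?S" by simp
  have "real (J div d) \<le> real J / real d" by (rule of_nat_div_le_of_nat)
  moreover have "real J / real d \<le> real (J div d) + 1"
    using floor_divide_of_nat_eq[of J d, where 'a = real] by linarith
  ultimately show ?thesis using up lo unfolding iff by linarith
qed

text \<open>Summed with multiplicity over all prime factors, the weights give
  \<open>bigOmega n - ln n / ln y >= 4 - 3\<close>. Primes from \<open>y\<close> on contribute at
  most 0, and by \<open>sq\<close> the smaller ones are simple.\<close>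

lemma richert_weight_ge_1:
  assumes "n > 0" "1 < y" "real n \<le> y ^ 3" "4 \<le> bigOmega n"
    and sq: "\<And>p. prime p \<Longrightarrow> real p < y \<Longrightarrow> \<not> p\<^sup>2 dvd n"
  shows "1 \<le> (\<Sum>p | p \<in> prime_factors n \<and> real p < y. 1 - ln (real p) / ln y)"
proof -
  have "ln (real n) = (\<Sum>p | prime p \<and> p \<le> n. real (multiplicity p n) * ln (real p))"
    by (rule ln_nat_eq_sum) (use assms in auto)
  also have "\<dots> = (\<Sum>p\<in>prime_factors n. real (multiplicity p n) * ln (real p))"
    by (rule sum.mono_neutral_right)
      (use assms in \<open>auto simp: in_prime_factors_iff not_dvd_imp_multiplicity_0 dest!: dvd_imp_le\<close>)
  finally have lnn: "ln (real n) = (\<Sum>p\<in>prime_factors n. real (multiplicity p n) * ln (real p))" .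
  have om: "real (bigOmega n) = (\<Sum>p\<in>prime_factors n. real (multiplicity p n))"
    unfolding bigOmega_def size_multiset_overloaded_eq
    by (simp add: count_prime_factorization_prime in_prime_factors_imp_prime)
  have "ln (real n) \<le> ln (y ^ 3)" using assms by (subst ln_le_cancel_iff) auto
  then have "ln (real n) / ln y \<le> 3" using assms by (simp add: ln_realpow field_simps)
  then have "1 \<le> real (bigOmega n) - ln (real n) / ln y" using assms by linarith
  also have "\<dots> = (\<Sum>p\<in>prime_factors n. real (multiplicity p n) * (1 - ln (real p) / ln y))"
    unfolding om lnn by (simp add: sum_divide_distrib sum_subtractf algebra_simps)
  also have "\<dots> \<le> (\<Sum>p\<in>prime_factors n. if real p < y then 1 - ln (real p) / ln y else 0)"
  proof (rule sum_mono)
    fix p assume "p \<in> prime_factors n"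
    then have p: "prime p" "p dvd n" by (auto simp: in_prime_factors_iff)
    show "real (multiplicity p n) * (1 - ln (real p) / ln y) \<le> (if real p < y then 1 - ln (real p) / ln y else 0)"
    proof (cases "real p < y")
      case True
      have "multiplicity p n = 1"
        by (rule multiplicity_eqI) (use p sq[OF p(1) True] in \<open>auto simp: numeral_2_eq_2\<close>)
      then show ?thesis using True by simp
    next
      case False
      then have "1 \<le> ln (real p) / ln y" using assms by simp
      then show ?thesis using False by (simp add: mult_nonneg_nonpos)
    qed
  qed
  also have "\<dots> = (\<Sum>p | p \<in> prime_factors n \<and> real p < y. 1 - ln (real p) / ln y)"
    by (simp add: sum.inter_filter)
  finally show ?thesis .
qed

text \<open>The loss of the lower bound at \<open>s = (49/50) / (1/5)\<close>; tenth powers make the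
  comparison rational.\<close>

lemma four_powr_le: "4 powr (3 - 49/10) \<le> (9/125 :: real)"
proof -
  have "(4 powr (3 - 49/10)) ^ 10 = (4 powr (-19) :: real)"
    by (simp add: powr_realpow[symmetric] powr_powr)
  also have "\<dots> = (1 / 4 ^ 19 :: real)" by (simp add: powr_minus powr_realpow[symmetric] field_simps)
  also have "\<dots> \<le> (9/125) ^ 10" by (simp add: field_simps)
  finally show ?thesis using power_le_imp_le_base[of "4 powr (3 - 49/10)" 9 "9/125 :: real"] by simp
qed

context linear_sieve begin

section \<open>Numerical bound for the average weight\<close>

text \<open>As \<open>exp (1/p) <= 1 / (1 - 1/p)\<close>, the density hypothesis contains the upper
  half of Mertens' second theorem for \<open>P\<close>; the extra \<open>1/1000\<close> bounds
  \<open>ln (1 + \<epsilon>)\<close>.\<close>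

lemma sum_inverse_segment:
  assumes "1 < w" "w \<le> z"
  shows "(\<Sum>p | p \<in> P \<and> w \<le> real p \<and> real p < z. 1 / real p) \<le> ln (ln z / ln w) + 1 / 1000"
proof -
  let ?S = "{p \<in> P. w \<le> real p \<and> real p < z}"
  have fin: "finite ?S" by (rule finite_subset[OF _ finite_nat_less_real[of P z]]) auto
  have p: "0 < 1 - 1 / real p" if "p \<in> ?S" for p
    using that ge_2_P[of p] by auto
  have pos: "0 < (\<Prod>p\<in>?S. 1 - 1 / real p)" by (rule prod_pos) (use p in auto)
  have r: "1 \<le> ln z / ln w" using assms by simp
  have "exp (\<Sum>p\<in>?S. 1 / real p) = (\<Prod>p\<in>?S. exp (1 / real p))" by (rule exp_sum[OF fin])
  also have "\<dots> \<le> (\<Prod>p\<in>?S. 1 / (1 - 1 / real p))"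
  proof (rule prod_mono)
    fix q assume q: "q \<in> ?S"
    have "1 - 1 / real q \<le> exp (- (1 / real q))" using exp_ge_add_one_self[of "- (1 / real q)"] by simp
    then show "0 \<le> exp (1 / real q) \<and> exp (1 / real q) \<le> 1 / (1 - 1 / real q)"
      using p[OF q] by (simp add: exp_minus field_simps)
  qed
  also have "\<dots> = V w / V z"
    unfolding prod_minus_split[OF assms(2), of P] prod_dividef using V_pos[of w] by simp
  also have "\<dots> \<le> (1 + \<epsilon>) * (ln z / ln w)"
    using dimension[OF assms] V_pos[of z] by (simp add: divide_le_eq)
  finally have "exp (\<Sum>p\<in>?S. 1 / real p) \<le> (1 + \<epsilon>) * (ln z / ln w)" .
  moreover have "0 < (1 + \<epsilon>) * (ln z / ln w)" by (rule mult_pos_pos) (use eps r in linarith)+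
  ultimately have "(\<Sum>p\<in>?S. 1 / real p) \<le> ln ((1 + \<epsilon>) * (ln z / ln w))"
    by (simp only: ln_ge_iff)
  also have "\<dots> = ln (1 + \<epsilon>) + ln (ln z / ln w)" using eps r by (subst ln_mult) auto
  also have "ln (1 + \<epsilon>) \<le> 1 / 1000" using ln_add_one_self_le_self[of \<epsilon>] eps by linarith
  finally show ?thesis by simp
qed

definition segment :: "real \<Rightarrow> real \<Rightarrow> real \<Rightarrow> nat set" where
  "segment q a b = {p \<in> P. q powr a \<le> real p \<and> real p < q powr b}"

lemma finite_segment [simp]: "finite (segment q a b)"
  unfolding segment_def by (rule finite_subset[OF _ finite_nat_less_real[of P "q powr b"]]) auto

lemma sum_segment_split:
  assumes "1 < q" "a \<le> b" "b \<le> c"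
  shows "sum f (segment q a c) = sum f (segment q a b) + sum f (segment q b c)"
proof -
  have "q powr a \<le> q powr b" "q powr b \<le> q powr c" using assms by auto
  then have "segment q a c = segment q a b \<union> segment q b c" by (auto simp: segment_def)
  then show ?thesis by (simp only:) (rule sum.union_disjoint[OF finite_segment finite_segment], auto simp: segment_def)
qed

text \<open>\<open>c\<close> is a rational upper bound for \<open>ln (b / a)\<close>, certified by
  the quadratic Taylor polynomial of \<open>exp\<close>.\<close>

lemma sum_inverse_segment_powr:
  assumes "1 < q" "0 < a" "a \<le> b" "0 \<le> c" "b / a \<le> 1 + c + c\<^sup>2 / 2"
  shows "(\<Sum>p\<in>segment q a b. 1 / real p) \<le> c + 1 / 1000"
proof -
  have "(\<Sum>p\<in>segment q a b. 1 / real p) \<le> ln (ln (q powr b) / ln (q powr a)) + 1 / 1000"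
    unfolding segment_def by (rule sum_inverse_segment) (use assms in auto)
  also have "ln (q powr b) / ln (q powr a) = b / a" using assms by (simp add: ln_powr)
  also have "ln (b / a) \<le> c"
  proof -
    have "b / a \<le> exp c" using exp_lower_Taylor_quadratic[OF assms(4)] assms(5) by linarith
    then have "ln (b / a) \<le> ln (exp c)" using assms by (subst ln_le_cancel_iff) auto
    then show ?thesis by simp
  qed
  finally show ?thesis by simp
qed

text \<open>The Richert weight \<open>1 - ln p / ln y\<close> times the factor \<open>4.77 * ln z / ln (D / p)\<close> from
  \<open>upper_bound\<close>, for \<open>y = q powr (17/25)\<close>, \<open>z = q powr (1/5)\<close> and \<open>D = q powr (49/50)\<close>.\<close>

definition weight :: "real \<Rightarrow> nat \<Rightarrow> real" where
  "weight q p = (1 - ln (real p) / (17/25 * ln q)) * (477/500 * ln q / (49/50 * ln q - ln (real p)))"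

text \<open>With \<open>t = ln p / ln q\<close> the weight is a multiple of
  \<open>(1 - 25/17 * t) / (49/50 - t)\<close>, which decreases because
  \<open>25/17 * 49/50 > 1\<close>; its value at the left end \<open>a\<close> bounds it on the
  segment.\<close>

lemma sum_weight_segment:
  assumes "1 < q" "0 < a" "a \<le> b" "b \<le> 17/25" "0 \<le> c" "b / a \<le> 1 + c + c\<^sup>2 / 2"
  shows "(\<Sum>p\<in>segment q a b. weight q p / real p) \<le> 477/500 * (1 - 25/17 * a) / (49/50 - a) * (c + 1/1000)"
proof -
  let ?g = "477/500 * (1 - 25/17 * a) / (49/50 - a)"
  have g: "0 \<le> ?g" using assms by simp
  have "(\<Sum>p\<in>segment q a b. weight q p / real p) \<le> (\<Sum>p\<in>segment q a b. ?g * (1 / real p))"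
  proof (rule sum_mono)
    fix p assume p: "p \<in> segment q a b"
    then have p2: "2 \<le> p" using ge_2_P by (auto simp: segment_def)
    define t where "t = ln (real p) / ln q"
    have L: "0 < ln q" using assms by simp
    have lp: "ln (real p) = t * ln q" using L by (simp add: t_def)
    have "ln (q powr a) \<le> ln (real p)" using p p2 assms by (subst ln_le_cancel_iff) (auto simp: segment_def)
    then have ta: "a \<le> t" using L assms unfolding lp by (simp add: ln_powr)
    have "ln (real p) \<le> ln (q powr b)" using p p2 assms by (subst ln_le_cancel_iff) (auto simp: segment_def)
    then have tb: "t \<le> 17/25" using L assms unfolding lp by (simp add: ln_powr)
    have "weight q p = 477/500 * ((1 - 25/17 * t) / (49/50 - t))"
    proof -
      have "49/50 * ln q - t * ln q = (49/50 - t) * ln q" by (simp add: algebra_simps)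
      then show ?thesis unfolding weight_def lp using L tb by simp
    qed
    also have "(1 - 25/17 * t) / (49/50 - t) \<le> (1 - 25/17 * a) / (49/50 - a)"
    proof -
      have "(1 - 25/17 * t) * (49/50 - a) \<le> (1 - 25/17 * a) * (49/50 - t)"
        using ta by (simp add: algebra_simps)
      then show ?thesis using ta tb by (simp add: frac_le_eq divide_le_eq pos_le_divide_eq mult.commute)
    qed
    finally have "weight q p \<le> ?g" by simp
    then have "weight q p / real p \<le> ?g / real p" by (rule divide_right_mono) simp
    then show "weight q p / real p \<le> ?g * (1 / real p)" by (simp only: times_divide_eq_right mult_1_right)
  qed
  also have "\<dots> = ?g * (\<Sum>p\<in>segment q a b. 1 / real p)" by (rule sum_distrib_left[symmetric])
  also have "\<dots> \<le> ?g * (c + 1/1000)"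
    by (rule mult_left_mono[OF sum_inverse_segment_powr g]) (use assms in auto)
  finally show ?thesis .
qed

text \<open>An upper Riemann sum over five segments. The numbers \<open>83/200\<close>,
  \<open>73/250\<close>, \<open>9/40\<close>, \<open>23/125\<close>, \<open>63/500\<close> slightly
  exceed the logarithms of \<open>3/2\<close>, \<open>4/3\<close>, \<open>5/4\<close>,
  \<open>6/5\<close>, \<open>17/15\<close>.\<close>

lemma sum_weight_le:
  assumes "1 < q"
  shows "(\<Sum>p\<in>segment q (1/5) (17/25). weight q p / real p) \<le> 22/25"
    and "(\<Sum>p\<in>segment q (1/5) (17/25). 1 / real p) \<le> 13/10"
proof -
  have split: "sum f (segment q (1/5) (17/25)) = sum f (segment q (1/5) (3/10)) + sum f (segment q (3/10) (2/5))
     + sum f (segment q (2/5) (1/2)) + sum f (segment q (1/2) (3/5)) + sum f (segment q (3/5) (17/25))" for f :: "nat \<Rightarrow> real"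
    using sum_segment_split[OF assms, of "1/5" "3/10" "17/25" f]
      sum_segment_split[OF assms, of "3/10" "2/5" "17/25" f]
      sum_segment_split[OF assms, of "2/5" "1/2" "17/25" f]
      sum_segment_split[OF assms, of "1/2" "3/5" "17/25" f] by simp
  have "(\<Sum>p\<in>segment q (1/5) (17/25). weight q p / real p) \<le>
     477/500 * (1 - 25/17 * (1/5)) / (49/50 - (1/5)) * (83/200 + 1/1000)
   + 477/500 * (1 - 25/17 * (3/10)) / (49/50 - (3/10)) * (73/250 + 1/1000)
   + 477/500 * (1 - 25/17 * (2/5)) / (49/50 - (2/5)) * (9/40 + 1/1000)
   + 477/500 * (1 - 25/17 * (1/2)) / (49/50 - (1/2)) * (23/125 + 1/1000)
   + 477/500 * (1 - 25/17 * (3/5)) / (49/50 - (3/5)) * (63/500 + 1/1000)"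
    unfolding split
    by (intro add_mono sum_weight_segment assms) (simp_all add: power2_eq_square)
  also have "\<dots> \<le> 22/25" by simp
  finally show "(\<Sum>p\<in>segment q (1/5) (17/25). weight q p / real p) \<le> 22/25" .
  have "(\<Sum>p\<in>segment q (1/5) (17/25). 1 / real p) \<le>
     (83/200 + 1/1000) + (73/250 + 1/1000) + (9/40 + 1/1000) + (23/125 + 1/1000) + (63/500 + 1/1000)"
    unfolding split
    by (intro add_mono sum_inverse_segment_powr assms) (simp_all add: power2_eq_square)
  then show "(\<Sum>p\<in>segment q (1/5) (17/25). 1 / real p) \<le> 13/10" by simp
qed

text \<open>Each sifted \<open>n\<close> is counted at least once on the right: by a square
  \<open>p ^ 2\<close> dividing it if there is one in the range, otherwise through its Richert
  weights.\<close>

lemma sifted_le_weighted_sum: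
  assumes "1 < y"
    and A: "\<And>n. n \<in> A \<Longrightarrow> 0 < n \<and> real n \<le> y ^ 3 \<and> 4 \<le> bigOmega n"
    and primes: "\<And>n p. n \<in> A \<Longrightarrow> prime p \<Longrightarrow> p dvd n \<Longrightarrow> p \<in> P"
  shows "real (card (sifted 1 z)) \<le>
    (\<Sum>p | p \<in> P \<and> z \<le> real p \<and> real p < y.
       (1 - ln (real p) / ln y) * real (card (sifted p z)) + real (card {n \<in> A. p\<^sup>2 dvd n}))"
proof -
  let ?R = "{p \<in> P. z \<le> real p \<and> real p < y}"
  have finR: "finite ?R" by (rule finite_subset[OF _ finite_nat_less_real[of P y]]) auto
  have wt: "0 \<le> 1 - ln (real p) / ln y" if "p \<in> ?R" for p
    using that assms(1) ge_2_P[of p] by (auto simp: divide_le_eq_1)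
  have "1 \<le> (\<Sum>p\<in>?R. (1 - ln (real p) / ln y) * of_bool (p dvd n) + of_bool (p\<^sup>2 dvd n))"
    if n: "n \<in> sifted 1 z" for n
  proof (cases "\<exists>p\<in>?R. p\<^sup>2 dvd n")
    case True
    then obtain p where p: "p \<in> ?R" "p\<^sup>2 dvd n" by auto
    have "1 \<le> (1 - ln (real p) / ln y) * of_bool (p dvd n) + of_bool (p\<^sup>2 dvd n)"
      using p wt[OF p(1)] by simp
    also have "\<dots> \<le> (\<Sum>p\<in>?R. (1 - ln (real p) / ln y) * of_bool (p dvd n) + of_bool (p\<^sup>2 dvd n))"
      by (rule member_le_sum[OF p(1) _ finR]) (use wt in auto)
    finally show ?thesis .
  next
    case False
    have nA: "n \<in> A" using n by (simp add: sifted_def)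
    have big: "p \<in> ?R" if "prime p" "p dvd n" "real p < y" for p
    proof -
      have "p \<in> P" using primes[OF nA that(1,2)] .
      moreover have "\<not> real p < z" using n that(2) \<open>p \<in> P\<close> by (auto simp: sifted_def)
      ultimately show ?thesis using that(3) by simp
    qed
    have "1 \<le> (\<Sum>p | p \<in> prime_factors n \<and> real p < y. 1 - ln (real p) / ln y)"
    proof (rule richert_weight_ge_1)
      show "\<not> p\<^sup>2 dvd n" if "prime p" "real p < y" for p
      proof
        assume sq: "p\<^sup>2 dvd n"
        have "p dvd p\<^sup>2" by (simp add: power2_eq_square)
        then have "p dvd n" using sq by (rule dvd_trans)
        then show False using False big[OF that(1) _ that(2)] sq by blast
      qed
    qed (use A[OF nA] assms(1) in auto)
    also have "\<dots> \<le> (\<Sum>p\<in>?R. (1 - ln (real p) / ln y) * of_bool (p dvd n))"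
    proof -
      let ?F = "{p. p \<in> prime_factors n \<and> real p < y}"
      have "(\<Sum>p\<in>?F. 1 - ln (real p) / ln y) = (\<Sum>p\<in>?F. (1 - ln (real p) / ln y) * of_bool (p dvd n))"
        by (rule sum.cong) (auto simp: in_prime_factors_iff)
      also have "\<dots> \<le> (\<Sum>p\<in>?R. (1 - ln (real p) / ln y) * of_bool (p dvd n))"
      proof (rule sum_mono2[OF finR])
        show "?F \<subseteq> ?R"
        proof
          fix p assume "p \<in> ?F"
          then have "prime p" "p dvd n" "real p < y" by (simp_all add: in_prime_factors_iff)
          then show "p \<in> ?R" by (rule big)
        qed
      qed (use wt in simp)
      finally show ?thesis .
    qed
    also have "\<dots> \<le> (\<Sum>p\<in>?R. (1 - ln (real p) / ln y) * of_bool (p dvd n) + of_bool (p\<^sup>2 dvd n))"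
      by (rule sum_mono) auto
    finally show ?thesis .
  qed
  then have "(\<Sum>n\<in>sifted 1 z. 1) \<le>
    (\<Sum>n\<in>sifted 1 z. \<Sum>p\<in>?R. (1 - ln (real p) / ln y) * of_bool (p dvd n) + of_bool (p\<^sup>2 dvd n))"
    by (rule sum_mono)
  also have "\<dots> = (\<Sum>p\<in>?R. \<Sum>n\<in>sifted 1 z. (1 - ln (real p) / ln y) * of_bool (p dvd n) + of_bool (p\<^sup>2 dvd n))"
    by (rule sum.swap)
  also have "\<dots> \<le> (\<Sum>p\<in>?R. (1 - ln (real p) / ln y) * real (card (sifted p z)) + real (card {n \<in> A. p\<^sup>2 dvd n}))"
  proof (rule sum_mono)
    fix p assume "p \<in> ?R"
    have 1: "(\<Sum>n\<in>sifted 1 z. of_bool (p dvd n)) = real (card (sifted p z))"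
    proof -
      have "sifted 1 z \<inter> {n. p dvd n} = sifted p z" by (auto simp: sifted_def)
      then show ?thesis by (simp add: of_bool_def sum.If_cases)
    qed
    have 2: "(\<Sum>n\<in>sifted 1 z. of_bool (p\<^sup>2 dvd n)) \<le> real (card {n \<in> A. p\<^sup>2 dvd n})"
    proof -
      have "card (sifted 1 z \<inter> {n. p\<^sup>2 dvd n}) \<le> card {n \<in> A. p\<^sup>2 dvd n}"
        by (rule card_mono) (auto simp: sifted_def)
      then show ?thesis by (simp add: of_bool_def sum.If_cases)
    qed
    have "(\<Sum>n\<in>sifted 1 z. (1 - ln (real p) / ln y) * of_bool (p dvd n) + of_bool (p\<^sup>2 dvd n)) =
      (1 - ln (real p) / ln y) * (\<Sum>n\<in>sifted 1 z. of_bool (p dvd n)) + (\<Sum>n\<in>sifted 1 z. of_bool (p\<^sup>2 dvd n))"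
      by (simp only: sum.distrib sum_distrib_left)
    then show "(\<Sum>n\<in>sifted 1 z. (1 - ln (real p) / ln y) * of_bool (p dvd n) + of_bool (p\<^sup>2 dvd n))
      \<le> (1 - ln (real p) / ln y) * real (card (sifted p z)) + real (card {n \<in> A. p\<^sup>2 dvd n})"
      using 1 2 by simp
  qed
  finally show ?thesis by simp
qed

text \<open>No prime lies below 2, so \<open>V 2 = 1\<close>, and the density hypothesis from 2 to
  \<open>z\<close> forces the bound.\<close>

lemma V_lower_bound:
  assumes "2 \<le> z"
  shows "1 / V z \<le> 2 * ln z"
proof -
  have "{p \<in> P. real p < 2} = {}" using ge_2_P by force
  then have "V 2 = 1" by (simp only: prod_minus_def prod.empty)
  then have "1 \<le> (1 + \<epsilon>) * (ln z / ln 2) * V z" using dimension[of 2 z] assms by simp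
  then have "1 / V z \<le> (1 + \<epsilon>) * (ln z / ln 2)" using V_pos[of z] by (simp add: divide_le_eq)
  also have "\<dots> = (1 + \<epsilon>) / ln 2 * ln z" by simp
  also have "\<dots> \<le> 2 * ln z"
    using ln2_ge_two_thirds eps assms by (intro mult_right_mono) (auto simp: divide_le_eq)
  finally show ?thesis .
qed

text \<open>If all elements of \<open>A\<close> have at least four prime factors, the lower bound
  and the weighted upper bound for the sifted set must be compatible, although their main terms
  differ by \<open>6/125\<close>. Hence \<open>X\<close> is bounded by error terms.\<close>

lemma bound_if_no_P3:
  assumes q: "32 \<le> q"
    and A: "\<And>n. n \<in> A \<Longrightarrow> 0 < n \<and> real n \<le> (q powr (17/25)) ^ 3 \<and> 4 \<le> bigOmega n"
    and primes: "\<And>n p. n \<in> A \<Longrightarrow> prime p \<Longrightarrow> p dvd n \<Longrightarrow> p \<in> P"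
  shows "X / 25 \<le> ln q * (3 * q powr (49/50) * ln q + 13/10 * (X * q powr (-(1/5))) + 2 * q powr (17/25))"
proof -
  define L where "L = ln q"
  define z where "z = q powr (1/5)"
  define y where "y = q powr (17/25)"
  define D where "D = q powr (49/50)"
  have q1: "1 < q" using q by simp
  have L: "0 < L" using q1 by (simp add: L_def)
  have lz: "ln z = L / 5" and ly: "ln y = 17/25 * L" and lD: "ln D = 49/50 * L"
    using q by (auto simp: z_def y_def D_def L_def ln_powr)
  \<comment> \<open>\<open>32 = 2 ^ 5\<close> ensures \<open>z >= 2\<close>, as
    \<open>V_lower_bound\<close> requires.\<close>
  have "32 powr (1/5) \<le> z" unfolding z_def by (rule powr_mono2) (use q in auto)
  moreover have "32 powr (1/5) = (2::real)"
    using powr_powr[of 2 5 "1/5"] by (simp add: powr_numeral)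
  ultimately have z2: "2 \<le> z" by simp
  have z: "1 < z" and y: "1 < y" and D: "1 < D" using q by (auto simp: z_def y_def D_def)
  have R: "{p \<in> P. z \<le> real p \<and> real p < y} = segment q (1/5) (17/25)"
    by (simp add: segment_def z_def y_def)
  let ?R = "segment q (1/5) (17/25)"
  have iV: "1 / V z \<le> L" using V_lower_bound[OF z2] L unfolding lz by simp
  have W: "W z \<le> L" "1 \<le> W z" using W_le[of z] iV W_ge_1 by auto
  have low: "X * V z * (1 - 9/125) - D * W z \<le> real (card (sifted 1 z))"
  proof -
    have r: "ln D / ln z = 49/10" using L by (simp add: lD lz)
    have "X / real 1 * V z * (1 - 4 powr (3 - ln D / ln z)) - D * W z \<le> real (card (sifted 1 z))"
    proof (rule lower_bound[OF z])
      show "3 \<le> ln D / ln z" unfolding r by simp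
    qed (use D in \<open>auto simp: admissible_def\<close>)
    moreover have "X * V z * (1 - 9/125) \<le> X * V z * (1 - 4 powr (3 - 49/10))"
      using four_powr_le X_nonneg V_pos[of z] by (intro mult_left_mono) auto
    ultimately show ?thesis unfolding r by simp
  qed
  have up: "(1 - ln (real p) / ln y) * real (card (sifted p z)) + real (card {n \<in> A. p\<^sup>2 dvd n})
     \<le> X * V z * (weight q p / real p) + D * W z * (1 / real p) + X / z * (1 / real p) + 1"
    if p: "p \<in> ?R" for p
  proof -
    have pP: "p \<in> P" "z \<le> real p" "real p < y" using p unfolding R[symmetric] by auto
    have p2: "2 \<le> p" using ge_2_P[OF pP(1)] .
    have lp: "L / 5 \<le> ln (real p)" "ln (real p) \<le> 17/25 * L"
    proof -
      have "ln z \<le> ln (real p)" "ln (real p) \<le> ln y" using pP p2 z by auto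
      then show "L / 5 \<le> ln (real p)" "ln (real p) \<le> 17/25 * L" by (auto simp: lz ly)
    qed
    have w: "0 \<le> 1 - ln (real p) / ln y" "1 - ln (real p) / ln y \<le> 1"
      using lp L p2 unfolding ly by (auto simp: divide_le_eq_1)
    have lDp: "ln (D / real p) = 49/50 * L - ln (real p)" using D p2 by (simp add: ln_div lD)
    have "0 < ln (D / real p)" using lp L unfolding lDp by simp
    then have Dp: "1 < D / real p" using D p2 by (simp add: ln_gt_zero_iff)
    have adm: "admissible p z"
      unfolding admissible_def
    proof (intro conjI allI impI)
      fix r assume "prime r" "r dvd p"
      then have "r = p" using primes_dvd_imp_eq prime_P[OF pP(1)] by blast
      then show "r \<in> P" "z \<le> real r" using pP by simp_all
    qed (use p2 in simp)
    \<comment> \<open>As \<open>p >= z\<close>, the parameter at level \<open>D / p\<close> is at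
      most \<open>5 * (49/50 - 1/5) = 3.9\<close>, within the range of
      \<open>upper_bound\<close>.\<close>
    have "real (card (sifted p z)) \<le> X / real p * V z * (4.77 * (ln z / ln (D / real p))) + D / real p * W z"
      by (rule upper_bound[OF z adm Dp]) (use lp L in \<open>auto simp: lDp lz divide_le_eq\<close>)
    then have "(1 - ln (real p) / ln y) * real (card (sifted p z)) \<le>
      (1 - ln (real p) / ln y) * (X / real p * V z * (4.77 * (ln z / ln (D / real p))) + D / real p * W z)"
      by (rule mult_left_mono) (use w in simp)
    also have "\<dots> = X * V z * (weight q p / real p) + (1 - ln (real p) / ln y) * (D * W z * (1 / real p))"
    proof -
      have "weight q p = (1 - ln (real p) / ln y) * (4.77 * (ln z / ln (D / real p)))"
        unfolding weight_def lDp lz ly L_def[symmetric] by simp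
      then have "weight q p / real p = (1 - ln (real p) / ln y) * (4.77 * (ln z / ln (D / real p))) / real p"
        by (rule arg_cong)
      moreover have "a * (X / real p * V z * h + D / real p * W z) = X * V z * (a * h / real p) + a * (D * W z * (1 / real p))"
        for a h :: real by (simp add: distrib_left)
      ultimately show ?thesis by presburger
    qed
    also have "\<dots> \<le> X * V z * (weight q p / real p) + D * W z * (1 / real p)"
      using mult_right_mono[OF w(2), of "D * W z * (1 / real p)"] D W by simp
    finally have 1: "(1 - ln (real p) / ln y) * real (card (sifted p z)) \<le> X * V z * (weight q p / real p) + D * W z * (1 / real p)" .
    have "\<bar>real (card {n \<in> A. p\<^sup>2 dvd n}) - X / real (p\<^sup>2)\<bar> \<le> 1"
    proof (rule level)
      fix r assume r: "prime r" "r dvd p\<^sup>2"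
      then have "r dvd p" using prime_dvd_power by blast
      then have "r = p" using primes_dvd_imp_eq[OF r(1) prime_P[OF pP(1)]] by blast
      then show "r \<in> P" using pP by simp
    qed (use p2 in simp)
    then have "real (card {n \<in> A. p\<^sup>2 dvd n}) \<le> X / real (p\<^sup>2) + 1" by linarith
    also have "X / real (p\<^sup>2) = X / real p * (1 / real p)" by (simp add: power2_eq_square)
    also have "\<dots> \<le> X / z * (1 / real p)"
      by (intro mult_right_mono divide_left_mono) (use pP z p2 X_nonneg in auto)
    finally show ?thesis using 1 by simp
  qed
  have card: "real (card ?R) \<le> 2 * y"
  proof -
    have "card ?R \<le> card {..nat \<lfloor>y\<rfloor>}"
      by (rule card_mono) (auto simp: R[symmetric] le_nat_floor)
    then show ?thesis using y by simp linarith
  qed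
  have "X * V z * (1 - 9/125) - D * W z \<le> real (card (sifted 1 z))" by (rule low)
  also have "\<dots> \<le> (\<Sum>p\<in>?R. (1 - ln (real p) / ln y) * real (card (sifted p z)) + real (card {n \<in> A. p\<^sup>2 dvd n}))"
    unfolding R[symmetric] by (rule sifted_le_weighted_sum) (use y A primes in \<open>auto simp: y_def\<close>)
  also have "\<dots> \<le> (\<Sum>p\<in>?R. X * V z * (weight q p / real p) + D * W z * (1 / real p) + X / z * (1 / real p) + 1)"
    by (rule sum_mono) (rule up)
  also have "\<dots> = X * V z * (\<Sum>p\<in>?R. weight q p / real p) + D * W z * (\<Sum>p\<in>?R. 1 / real p)
     + X / z * (\<Sum>p\<in>?R. 1 / real p) + real (card ?R)"
    by (simp only: sum.distrib sum_distrib_left) simp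
  also have "\<dots> \<le> X * V z * (22/25) + D * W z * (13/10) + X / z * (13/10) + 2 * y"
    by (intro add_mono mult_left_mono sum_weight_le card q1) (use X_nonneg V_pos[of z] D W z in auto)
  \<comment> \<open>\<open>23/10\<close> is \<open>13/10\<close> from the weighted sum plus 1 from
    the lower bound.\<close>
  finally have "X * V z * (6/125) \<le> D * W z * (23/10) + X / z * (13/10) + 2 * y" by simp
  also have "\<dots> \<le> D * L * (23/10) + X / z * (13/10) + 2 * y" using W D by simp
  finally have "X * V z * (6/125) \<le> D * L * (23/10) + X / z * (13/10) + 2 * y" .
  then have "X * V z * (1/25) \<le> 3 * D * L + 13/10 * (X / z) + 2 * y"
  proof -
    have nonneg: "0 \<le> X * V z" "0 \<le> D * L" using X_nonneg V_pos[of z] D L by auto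
    have aux: "a * (1/25) \<le> 3 * b + 13/10 * c + 2 * y"
      if "0 \<le> a" "0 \<le> b" "a * (6/125) \<le> b * (23/10) + c * (13/10) + 2 * y" for a b c :: real
      using that by linarith
    show ?thesis
      using aux[OF nonneg \<open>X * V z * (6/125) \<le> D * L * (23/10) + X / z * (13/10) + 2 * y\<close>]
      by (simp only: mult.assoc)
  qed
  then have "1 / V z * (X * V z * (1/25)) \<le> 1 / V z * (3 * D * L + 13/10 * (X / z) + 2 * y)"
    using V_pos[of z] by (intro mult_left_mono) auto
  also have "\<dots> \<le> L * (3 * D * L + 13/10 * (X / z) + 2 * y)"
    by (rule mult_right_mono[OF iV]) (use D L X_nonneg z y in auto)
  also have "X / z = X * q powr (-(1/5))" by (simp only: z_def powr_minus_divide times_divide_eq_right mult_1_right)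
  finally show ?thesis using V_pos[of z] by (simp add: L_def D_def y_def)
qed

end

section \<open>Application to the progression 1 modulo \<open>q\<close>\<close>

text \<open>All primes of the set exceed \<open>w0\<close>, so the density is 1 up to
  \<open>w0\<close> and \<open>w\<close> can be raised to at least \<open>w0\<close>, where Mertens'
  product is precise. Omitting divisors of \<open>m\<close> is harmless, as each factor
  \<open>1 / (1 - 1/p)\<close> is at least 1.\<close>

lemma dimension_coprime_primes:
  fixes m w0 :: nat
  assumes w0: "2 \<le> w0" "fact w0 dvd m" and "0 \<le> \<epsilon>"
    and mertens: "\<And>w z. real w0 \<le> w \<Longrightarrow> w \<le> z \<Longrightarrow>
       (\<Prod>p | prime p \<and> w \<le> real p \<and> real p < z. 1 / (1 - 1 / real p)) \<le> (1 + \<epsilon>) * (ln z / ln w)"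
    and wz: "1 < w" "w \<le> z"
  shows "prod_minus {p. prime p \<and> \<not> p dvd m} w \<le> (1 + \<epsilon>) * (ln z / ln w) * prod_minus {p. prime p \<and> \<not> p dvd m} z"
proof -
  let ?P = "{p. prime p \<and> \<not> p dvd m}"
  have large: "w0 < p" if "p \<in> ?P" for p
  proof (rule ccontr)
    assume "\<not> w0 < p"
    then have "p dvd fact w0" using that by (simp add: prime_dvd_fact_iff)
    then show False using that dvd_trans[OF _ w0(2)] by blast
  qed
  have one: "prod_minus ?P x = 1" if "x \<le> real w0" for x
  proof -
    have "\<not> real p < x" if "p \<in> ?P" for p using large[OF that] \<open>x \<le> real w0\<close> by simp
    then have "{p \<in> ?P. real p < x} = {}" by blast
    then show ?thesis by (simp only: prod_minus_def prod.empty)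
  qed
  have r: "1 \<le> ln z / ln w" using wz by simp
  show ?thesis
  proof (cases "z \<le> real w0")
    case True
    have "1 * 1 \<le> (1 + \<epsilon>) * (ln z / ln w)" by (rule mult_mono) (use r assms(3) in auto)
    then show ?thesis using one[OF True] one[of w] True wz by simp
  next
    case False
    define v where "v = max w (real w0)"
    have v: "w \<le> v" "v \<le> z" "real w0 \<le> v" using False wz by (auto simp: v_def)
    have Vv: "prod_minus ?P w = prod_minus ?P v" using one[of w] one[of "real w0"] by (auto simp: v_def max_def)
    let ?S = "{p. p \<in> ?P \<and> v \<le> real p \<and> real p < z}"
    have f: "0 < 1 - 1 / real p" if "prime p" for p :: nat
      using prime_gt_1_nat[OF that] by simp
    have pos: "0 < prod_minus ?P z" "0 < prod_minus ?P v" "0 < (\<Prod>p\<in>?S. 1 - 1 / real p)"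
      unfolding prod_minus_def by (auto intro!: prod_pos f)
    have "prod_minus ?P v = prod_minus ?P z * (\<Prod>p\<in>?S. 1 / (1 - 1 / real p))"
      unfolding prod_minus_split[OF v(2), of ?P] prod_dividef using pos by simp
    also have "\<dots> \<le> prod_minus ?P z * (\<Prod>p | prime p \<and> v \<le> real p \<and> real p < z. 1 / (1 - 1 / real p))"
    proof (intro mult_left_mono prod_mono2)
      show "finite {p. prime p \<and> v \<le> real p \<and> real p < z}"
        by (rule finite_subset[OF _ finite_nat_less_real[of UNIV z]]) auto
      show "1 \<le> 1 / (1 - 1 / real p)" if "p \<in> {p. prime p \<and> v \<le> real p \<and> real p < z} - ?S" for p
        using that f[of p] by auto
      show "0 \<le> 1 / (1 - 1 / real p)" if "p \<in> ?S" for p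
        using that f[of p] by auto
    qed (use pos in auto)
    also have "\<dots> \<le> prod_minus ?P z * ((1 + \<epsilon>) * (ln z / ln v))"
      by (intro mult_left_mono mertens v) (use pos in auto)
    also have "\<dots> \<le> prod_minus ?P z * ((1 + \<epsilon>) * (ln z / ln w))"
      by (intro mult_left_mono divide_left_mono) (use pos wz v assms(3) in auto)
    finally show ?thesis unfolding Vv by (simp add: mult_ac)
  qed
qed

theorem theorem1:
  shows "\<exists>N0::nat. \<forall>n::nat \<ge> N0.
           (\<exists>x y::nat. 0 < x \<and> 0 < y \<and> n = x + y \<and> bigOmega (x + n * y) \<le> 3)
         \<or> (\<exists>x y::nat. 0 < x \<and> 0 < y \<and> n = x + y \<and> bigOmega (x^2 + n * y^2) \<le> 4)"
proof -
  obtain w0 :: nat where w0: "2 \<le> w0"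
    and mertens: "\<And>w z. real w0 \<le> w \<Longrightarrow> w \<le> z \<Longrightarrow>
       (\<Prod>p | prime p \<and> w \<le> real p \<and> real p < z. 1 / (1 - 1 / real p)) \<le> (1 + 1/1000) * (ln z / ln w)"
    by (rule mertens_product[of "1/1000"]) (simp, rule that)
  \<comment> \<open>Restricting \<open>y + 1\<close> to multiples of \<open>Q\<close> makes all values coprime to the primes up to \<open>w0\<close>,
    for which Mertens' theorem is not precise enough.\<close>
  define Q :: nat where "Q = fact w0"
  have Q: "2 \<le> Q" using fact_mono_nat[OF w0] by (simp add: Q_def)
  have "((\<lambda>q::real. ln q * (3 * q powr (49/50) * ln q + 13/10 * (q * q powr (-(1/5))) + 2 * q powr (17/25)) / q) \<longlongrightarrow> 0) at_top"
    by real_asymp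
  \<comment> \<open>The progression will have at least \<open>q / (2 * Q)\<close> terms, hence the
    threshold \<open>1 / (50 * Q)\<close> against \<open>J / 25\<close>.\<close>
  then have "eventually (\<lambda>q::real. ln q * (3 * q powr (49/50) * ln q + 13/10 * (q * q powr (-(1/5))) + 2 * q powr (17/25)) / q < 1 / (50 * real Q)) at_top"
    by (rule order_tendstoD(2)) (use Q in simp)
  \<comment> \<open>Here \<open>3 * 17/25 = 51/25\<close> exceeds 2.\<close>
  moreover have "eventually (\<lambda>q::real. 1 + q * q \<le> (q powr (17/25)) ^ 3) at_top" by real_asymp
  moreover have "eventually (\<lambda>q::real. max 32 (2 * real Q) \<le> q) at_top" by (rule eventually_ge_at_top)
  ultimately have "eventually (\<lambda>q::real. ln q * (3 * q powr (49/50) * ln q + 13/10 * (q * q powr (-(1/5))) + 2 * q powr (17/25)) / q < 1 / (50 * real Q)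
     \<and> 1 + q * q \<le> (q powr (17/25)) ^ 3 \<and> max 32 (2 * real Q) \<le> q) at_top"
    by eventually_elim auto
  then obtain q0 :: real where q0: "\<And>q. q0 \<le> q \<Longrightarrow>
     ln q * (3 * q powr (49/50) * ln q + 13/10 * (q * q powr (-(1/5))) + 2 * q powr (17/25)) / q < 1 / (50 * real Q)
     \<and> 1 + q * q \<le> (q powr (17/25)) ^ 3 \<and> max 32 (2 * real Q) \<le> q"
    unfolding eventually_at_top_linorder by blast
  have "\<exists>x y::nat. 0 < x \<and> 0 < y \<and> n = x + y \<and> bigOmega (x + n * y) \<le> 3" if n: "nat \<lceil>q0\<rceil> + 1 \<le> n" for n
  proof (rule ccontr)
    assume neg: "\<not> (\<exists>x y::nat. 0 < x \<and> 0 < y \<and> n = x + y \<and> bigOmega (x + n * y) \<le> 3)"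
    define q where "q = n - 1"
    have nq: "n = q + 1" using n by (simp add: q_def)
    have "q0 \<le> real q" using n unfolding nq by linarith
    note q = q0[OF this]
    note small = conjunct1[OF q] and cube = conjunct1[OF conjunct2[OF q]]
    have q32: "32 \<le> real q" "2 * real Q \<le> real q" using conjunct2[OF conjunct2[OF q]] by simp_all
    \<comment> \<open>With \<open>y + 1 = Q * j\<close> the value \<open>1 + q * (y + 1)\<close> is
      \<open>1 + m * j\<close>, and \<open>j <= J\<close> gives \<open>y <= n - 2\<close>, so
      \<open>x\<close> is positive.\<close>
    define m where "m = q * Q"
    define J where "J = q div Q"
    define A where "A = (\<lambda>j. 1 + m * j) ` {1..J}"
    define P where "P = {p. prime p \<and> \<not> p dvd m}"
    have m: "0 < m" using q32 Q by (auto simp: m_def)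
    have JQ: "Q * J \<le> q" by (simp add: J_def)
    interpret linear_sieve A P "real J" "1/1000"
    proof
      fix d :: nat assume d: "d > 0" "\<And>p. prime p \<Longrightarrow> p dvd d \<Longrightarrow> p \<in> P"
      have "coprime d m"
      proof (rule ccontr)
        assume "\<not> coprime d m"
        then obtain p where "prime p" "p dvd gcd d m"
          using prime_factor_nat[of "gcd d m"] by (auto simp: coprime_iff_gcd_eq_1)
        then show False using d(2)[of p] by (simp add: P_def)
      qed
      have "{n \<in> A. d dvd n} = (\<lambda>j. 1 + m * j) ` {j \<in> {1..J}. d dvd 1 + m * j}" by (auto simp: A_def)
      then have "card {n \<in> A. d dvd n} = card {j \<in> {1..J}. d dvd 1 + m * j}"
        using m by (simp add: card_image inj_on_def)
      then show "\<bar>real (card {n \<in> A. d dvd n}) - real J / real d\<bar> \<le> 1"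
        using card_dvd_progression[OF \<open>coprime d m\<close> d(1), of J] by simp
    next
      fix w z :: real assume "1 < w" "w \<le> z"
      then show "prod_minus P w \<le> (1 + 1/1000) * (ln z / ln w) * prod_minus P z"
        unfolding P_def by (intro dimension_coprime_primes[OF w0] mertens) (auto simp: m_def Q_def)
    qed (auto simp: A_def P_def)
    have "0 < k \<and> real k \<le> (real q powr (17/25)) ^ 3 \<and> 4 \<le> bigOmega k" if kA: "k \<in> A" for k
    proof -
      obtain j where j: "1 \<le> j" "j \<le> J" "k = 1 + m * j" using kA by (auto simp: A_def)
      have Qj: "Q * j \<le> q" using mult_le_mono2[OF j(2), of Q] JQ by linarith
      have Qj2: "2 \<le> Q * j" using mult_le_mono[OF Q j(1)] by simp
      define y where "y = Q * j - 1"
      define x where "x = n - y"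
      have xy: "0 < x" "0 < y" "n = x + y" using Qj Qj2 by (auto simp: x_def y_def nq)
      have "x + n * y = (x + y) + q * y" by (simp add: nq)
      also have "\<dots> = 1 + q * (y + 1)" unfolding xy(3)[symmetric] by (simp add: nq)
      also have "y + 1 = Q * j" using Qj2 by (simp add: y_def)
      also have "1 + q * (Q * j) = k" by (simp add: j m_def)
      finally have k: "x + n * y = k" .
      have "\<not> bigOmega k \<le> 3" using neg xy unfolding k[symmetric] by blast
      then have "4 \<le> bigOmega k" by simp
      moreover have "real k \<le> 1 + real q * real q"
      proof -
        have "k \<le> 1 + q * q" using mult_le_mono2[OF Qj, of q] j(3) by (simp add: m_def mult.assoc)
        then have "real k \<le> real (1 + q * q)" by (simp only: of_nat_le_iff)
        then show ?thesis by simp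
      qed
      then have "real k \<le> (real q powr (17/25)) ^ 3" using cube by (rule order_trans)
      moreover have "0 < k" by (simp add: j(3))
      ultimately show ?thesis by blast
    qed
    moreover have "p \<in> P" if kA: "k \<in> A" "prime p" "p dvd k" for k p
    proof -
      obtain j where "k = 1 + m * j" using kA by (auto simp: A_def)
      then have "\<not> p dvd m" using kA dvd_add_left_iff[of p "m * j" 1] by auto
      then show ?thesis using kA by (simp add: P_def)
    qed
    ultimately have *: "real J / 25 \<le> ln q * (3 * q powr (49/50) * ln q + 13/10 * (J * q powr (-(1/5))) + 2 * q powr (17/25))"
      by (intro bound_if_no_P3 q32)
    have "real J \<le> real q" by (simp add: J_def)
    then have "ln q * (3 * q powr (49/50) * ln q + 13/10 * (J * q powr (-(1/5))) + 2 * q powr (17/25))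
      \<le> ln q * (3 * q powr (49/50) * ln q + 13/10 * (q * q powr (-(1/5))) + 2 * q powr (17/25))"
      by (intro mult_left_mono add_mono mult_right_mono) (use q32 in auto)
    also have "\<dots> < q / (50 * real Q)"
    proof -
      have "0 < real q" using q32 by simp
      from small[unfolded pos_divide_less_eq[OF this]] show ?thesis by simp
    qed
    finally have 1: "real J / 25 < q / (50 * real Q)" using * by linarith
    have "real q / real Q \<le> real J + 1"
      unfolding J_def using floor_divide_of_nat_eq[of q Q, where 'a = real] by linarith
    moreover have "1 \<le> real J"
    proof -
      have "Q \<le> q" using q32 by linarith
      then show ?thesis using Q by (simp add: J_def div_greater_zero_iff Suc_le_eq)
    qed
    ultimately have "real q / real Q \<le> 2 * real J" by linarith
    then have "q / (50 * real Q) \<le> real J / 25" by simp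
    then show False using 1 by simp
  qed
  then show ?thesis by blast
qed

end
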